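(* Let $q,\xi\in[0,1)$. The $q$-Plancherel measures of both types are obtained from the Schur measure $\mu_{\mathrm S}[\lambda;t,\tilde t]$ under the following specializations (for all $n\ge1$): (i) squared type $\mu_{q\mathrm{PP}_S}[\lambda;\xi,q]$: $\quad t_n=\tilde t_n=-\dfrac{\xi^n}{n(q^{n/2}-q^{-n/2})}$; (ii) mixed type $\mu_{q\mathrm{PP}_M}[\lambda;\xi,q]$: $\quad t_n=-\dfrac{\xi^n}{n(q^{n/2}-q^{-n/2})}$, $\ \tilde t_n=\xi q^{-\frac12}\delta_{n,1}$.
   Context: For a partition $\lambda$ let $\lambda^{\mathrm T}$ be its transpose, $|\lambda|=\sum_i\lambda_i$, $b(\lambda)=\sum_{i\ge1}(i-1)\lambda_i$, and $h(i,j)=\lambda_i+\lambda_j^{\mathrm T}-i-j+1$ for $(i,j)\in\lambda$. The two $q$-Plancherel measures on the set of all partitions are $$\mu_{q\mathrm{PP}_S}[\lambda;\xi,q]=M(\xi;q)^{-1}(\xi^2q)^{|\lambda|}q^{2b(\lambda)}\prod_{(i,j)\in\lambda}\frac1{(1-q^{h(i,j)})^2},\qquad M(\xi;q)=\prod_{n\ge1}(1-\xi^2q^n)^{-n},$$ $$\mu_{q\mathrm{PP}_M}[\lambda;\xi,q]=\exp\Big(\frac{\xi^2}{q^{\frac12}-q^{-\frac12}}\Big)\,\xi^{2|\lambda|}q^{b(\lambda)}\prod_{(i,j)\in\lambda}\frac1{h(i,j)(1-q^{h(i,j)})}.$$ For variables $X=(x_1,x_2,\dots)$ the Schur function $s_\lambda(X)$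 is also written $s_\lambda(\{t_n\})$ with $t_n=\frac1n\sum_{i\ge1}x_i^n$; that is, $s_\lambda$ is regarded as a polynomial in the power sums $p_n=n\,t_n$. The Schur measure with parameters $t=(t_n)$, $\tilde t=(\tilde t_n)$ is $$\mu_{\mathrm S}[\lambda;t,\tilde t]=\frac1Z\,s_\lambda(\{t_n\})\,s_\lambda(\{\tilde t_n\}),\qquad Z=\sum_{\lambda}s_\lambda(\{t_n\})s_\lambda(\{\tilde t_n\})=\exp\Big(\sum_{n\ge1}n\,t_n\tilde t_n\Big).$$
   Formalization: The mixed measure's constant exp(ξ²/(q^{1/2}-q^{-1/2})), which is not normalizing and contradicts (ii) at the empty partition, is replaced by exp(-ξ²/(1-q)); at q=0, where q^{-1/2} is undefined, (i) takes t_n=0 and (ii) is stated as a limit q→0+. *)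

theory Defs
  imports
    "HOL-Analysis.Infinite_Sum"
    "HOL-Analysis.Infinite_Products"
    "HOL-Computational_Algebra.Formal_Power_Series"
    "Jordan_Normal_Form.Determinant"
begin

section \<open>Integer partitions\<close>

definition int_partitions :: "nat list set" where
  "int_partitions = {lam. sorted_wrt (\<ge>) lam \<and> (\<forall>x\<in>set lam. 0 < x)}"

text \<open>Rows and columns are numbered from \<open>1\<close>; parts beyond the length are \<open>0\<close>.\<close>

definition part :: "nat list \<Rightarrow> nat \<Rightarrow> nat" where
  "part lam i = (if 1 \<le> i \<and> i \<le> length lam then lam ! (i - 1) else 0)"

definition conj_part :: "nat list \<Rightarrow> nat \<Rightarrow> nat" where
  "conj_part lam j = card {i. 1 \<le> i \<and> i \<le> length lam \<and> j \<le> part lam i}"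

definition diagram :: "nat list \<Rightarrow> (nat \<times> nat) set" where
  "diagram lam = {(i, j). 1 \<le> i \<and> 1 \<le> j \<and> j \<le> part lam i}"

text \<open>On cells of the diagram the truncated subtraction is exact.\<close>

definition hook :: "nat list \<Rightarrow> nat \<times> nat \<Rightarrow> nat" where
  "hook lam = (\<lambda>(i, j). part lam i + conj_part lam j + 1 - i - j)"

definition b_stat :: "nat list \<Rightarrow> nat" where
  "b_stat lam = (\<Sum>i = 1..length lam. (i - 1) * part lam i)"


section \<open>Schur functions in the variables \<open>t\<^sub>n = p\<^sub>n / n\<close>\<close>

text \<open>The complete homogeneous symmetric function \<open>h\<^sub>k\<close> as a polynomial in \<open>t\<^sub>1, \<dots>, t\<^sub>k\<close>,
  read off from \<open>\<Sum>\<^sub>k h\<^sub>k z\<^sup>k = exp (\<Sum>\<^sub>n\<^sub>\<ge>\<^sub>1 t\<^sub>n z\<^sup>n)\<close>. The value \<open>t 0\<close> is ignored.\<close>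

definition complete_hom :: "(nat \<Rightarrow> real) \<Rightarrow> nat \<Rightarrow> real" where
  "complete_hom t k = fps_nth (fps_exp 1 oo Abs_fps (\<lambda>n. if n = 0 then 0 else t n)) k"

text \<open>The Jacobi--Trudi matrix \<open>h\<^bsub>\<lambda>\<^sub>i - i + j\<^esub>\<close>, with rows and columns numbered from \<open>0\<close> here;
  \<open>h\<close> vanishes at negative indices.\<close>

definition jacobi_trudi_mat :: "nat \<Rightarrow> nat list \<Rightarrow> (nat \<Rightarrow> real) \<Rightarrow> real mat" where
  "jacobi_trudi_mat n lam t = mat n n (\<lambda>(i, j).
     if i \<le> part lam (i + 1) + j then complete_hom t (part lam (i + 1) + j - i) else 0)"

definition schur :: "nat list \<Rightarrow> (nat \<Rightarrow> real) \<Rightarrow> real" where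
  "schur lam t = det (jacobi_trudi_mat (length lam) lam t)"

text \<open>Agreement with the Schur polynomial in finitely many variables: at the power sums of
  \<open>x\<^sub>0, \<dots>, x\<^bsub>n-1\<^esub>\<close> the function above is the ratio of alternants
  (lemma \<open>schur_bialternant\<close> below).\<close>

lemma fps_mult_linear_nth:
  fixes F :: "real fps"
  shows "fps_nth (F * (1 - fps_const c * fps_X)) m
    = fps_nth F m - (if m = 0 then 0 else c * fps_nth F (m - 1))"
proof -
  have "F * (1 - fps_const c * fps_X) = F - fps_const c * (F * fps_X)"
    by (simp add: algebra_simps)
  then show ?thesis by simp
qed

lemma complete_hom_power_sums:
  fixes x :: "nat \<Rightarrow> real" and n :: nat
  defines "t \<equiv> (\<lambda>k. (\<Sum>i<n. x i ^ k) / real k)"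
  shows "Abs_fps (complete_hom t) * (\<Prod>i<n. 1 - fps_const (x i) * fps_X) = 1"
proof -
  define T where "T = Abs_fps (\<lambda>n. if n = 0 then 0 else t n)"
  define H where "H = fps_exp 1 oo T"
  define L where "L = (\<lambda>i. 1 - fps_const (x i) * fps_X)"
  define G where "G = (\<lambda>i. Abs_fps (\<lambda>k. x i ^ Suc k))"
  have T0: "fps_nth T 0 = 0" by (simp add: T_def)
  have H: "Abs_fps (complete_hom t) = H"
    by (simp add: H_def T_def complete_hom_def fps_eq_iff)
  have dT: "fps_deriv T = (\<Sum>i<n. G i)"
    by (simp add: fps_eq_iff T_def t_def G_def fps_sum_nth del: of_nat_Suc)
  have dH: "fps_deriv H = H * fps_deriv T"
    using fps_compose_deriv[OF T0, of "fps_exp 1"] by (simp add: H_def)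
  have GL: "G i * L i = fps_const (x i)" for i
  proof (rule fps_ext)
    fix k show "fps_nth (G i * L i) k = fps_nth (fps_const (x i)) k"
      by (cases k) (simp_all add: G_def L_def fps_mult_linear_nth)
  qed
  have dL: "fps_deriv (L i) = - (G i * L i)" for i
    unfolding GL by (simp add: L_def)
  have dP: "fps_deriv (\<Prod>i<m. L i) = - ((\<Sum>i<m. G i) * (\<Prod>i<m. L i))" for m
    by (induction m) (simp_all add: dL algebra_simps)
  have "fps_deriv (H * (\<Prod>i<n. L i)) = 0"
    by (simp add: dH dP dT algebra_simps)
  then have "H * (\<Prod>i<n. L i) = fps_const (fps_nth (H * (\<Prod>i<n. L i)) 0)"
    by (simp only: fps_deriv_eq_0_iff)
  moreover have "fps_nth (\<Prod>i<m. L i) 0 = 1" for m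
    by (induction m) (simp_all add: L_def)
  ultimately show ?thesis
    unfolding H by (simp add: H_def L_def fps_compose_nth_0)
qed

lemma schur_padding:
  assumes "length lam \<le> n"
  shows "det (jacobi_trudi_mat n lam t) = schur lam t"
proof -
  define l m where "l = length lam" and "m = n - l"
  define A4 where "A4 = mat m m (\<lambda>(i, j). if i \<le> j then complete_hom t (j - i) else 0)"
  define A2 where "A2 = mat l m (\<lambda>(i, j). jacobi_trudi_mat n lam t $$ (i, j + l))"
  have n: "n = l + m" using assms by (simp add: l_def m_def)
  have "jacobi_trudi_mat n lam t =
      four_block_mat (jacobi_trudi_mat l lam t) A2 (0\<^sub>m m l) A4"
    by (rule eq_matI)
       (auto simp: n jacobi_trudi_mat_def A2_def A4_def part_def l_def)
  moreover have "det A4 = 1"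
  proof -
    have "det A4 = prod_list (diag_mat A4)"
      by (rule det_upper_triangular[of _ m]) (auto simp: A4_def)
    also have "\<dots> = (\<Prod>i\<in>{0..<m}. A4 $$ (i, i))"
      by (simp add: prod_list_diag_prod A4_def)
    also have "\<dots> = 1" by (simp add: A4_def complete_hom_def fps_compose_nth_0)
    finally show ?thesis .
  qed
  ultimately show ?thesis
    using det_four_block_mat_lower_left_zero[of "jacobi_trudi_mat l lam t" l A2 m "0\<^sub>m m l" A4]
    by (simp add: schur_def l_def A4_def A2_def jacobi_trudi_mat_def)
qed

lemma schur_bialternant:
  fixes x :: "nat \<Rightarrow> real"
  assumes "length lam \<le> n"
  shows "schur lam (\<lambda>k. (\<Sum>i<n. x i ^ k) / real k) * det (mat n n (\<lambda>(i, j). x i ^ (n - 1 - j)))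
       = det (mat n n (\<lambda>(i, j). x i ^ (part lam (j + 1) + (n - 1 - j))))"
proof -
  define t where "t = (\<lambda>k. (\<Sum>i<n. x i ^ k) / real k)"
  define H where "H = Abs_fps (complete_hom t)"
  define L where "L = (\<lambda>i. 1 - fps_const (x i) * fps_X)"
  define E where "E = (\<lambda>k. \<Prod>i\<in>{..<n} - {k}. L i)"
  define M where "M = mat n n (\<lambda>(k, l). fps_nth (E k) (n - 1 - l))"
  have deg: "fps_nth (\<Prod>i\<in>S. L i) m = 0" if "finite S" "card S < m" for S m
    using that
  proof (induction S arbitrary: m rule: finite_induct)
    case (insert a S)
    then obtain m' where m: "m = Suc m'" by (cases m) auto
    have "fps_nth (\<Prod>i\<in>insert a S. L i) m = fps_nth ((\<Prod>i\<in>S. L i) * L a) m"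
      using insert by (simp add: mult.commute)
    also have "\<dots> = 0"
      using insert m unfolding L_def fps_mult_linear_nth by simp
    finally show ?case .
  qed simp
  have HE: "H * E k = Abs_fps (\<lambda>m. x k ^ m)" if "k < n" for k
  proof -
    have "H * E k * L k = 1"
      using complete_hom_power_sums[of x n] that
      by (simp add: H_def t_def E_def L_def prod.remove[of "{..<n}" k] algebra_simps)
    moreover have "Abs_fps (\<lambda>m. x k ^ m) * L k = 1"
    proof (rule fps_ext)
      fix m show "fps_nth (Abs_fps (\<lambda>m. x k ^ m) * L k) m = fps_nth 1 m"
        by (cases m) (simp_all add: L_def fps_mult_linear_nth)
    qed
    moreover have "L k \<noteq> 0" 
      by (metis calculation(1) mult_zero_right zero_neq_one)
    ultimately show ?thesis by (metis mult_right_cancel)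
  qed
  have key: "mat n n (\<lambda>(i, j). x i ^ (part mu (j + 1) + (n - 1 - j)))
      = M * transpose_mat (jacobi_trudi_mat n mu t)" (is "?A = _") for mu
  proof (rule eq_matI)
    fix k j assume "k < dim_row (M * transpose_mat (jacobi_trudi_mat n mu t))"
      and "j < dim_col (M * transpose_mat (jacobi_trudi_mat n mu t))"
    then have k: "k < n" and j: "j < n" by (auto simp: M_def jacobi_trudi_mat_def)
    define a where "a = part mu (j + 1) + (n - 1 - j)"
    define f where "f = (\<lambda>r. if r \<le> a then fps_nth (E k) r * complete_hom t (a - r) else 0)"
    have "x k ^ a = fps_nth (E k * H) a"
      using HE[OF k] by (simp add: mult.commute)
    also have "\<dots> = (\<Sum>r\<in>{..a}. f r)"
      by (simp add: fps_mult_nth H_def f_def atMost_atLeast0)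
    also have "\<dots> = (\<Sum>r\<in>{..<n}. f r)"
    proof (rule sum.mono_neutral_cong)
      fix r assume "r \<in> {..a} - {..<n}"
      then show "f r = 0" using k deg[of "{..<n} - {k}" r] by (auto simp: f_def E_def)
    qed (auto simp: f_def)
    also have "\<dots> = (\<Sum>l\<in>{..<n}. f (n - 1 - l))"
      by (rule sum.reindex_bij_witness[of _ "\<lambda>l. n - 1 - l" "\<lambda>l. n - 1 - l"]) auto
    also have "\<dots> = (\<Sum>l\<in>{..<n}. M $$ (k, l) * jacobi_trudi_mat n mu t $$ (j, l))"
    proof (rule sum.cong)
      fix l assume l: "l \<in> {..<n}"
      have "(n - 1 - l \<le> a) = (j \<le> part mu (j + 1) + l)"
        "j \<le> part mu (j + 1) + l \<Longrightarrow> a - (n - 1 - l) = part mu (j + 1) + l - j"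
        using j l by (auto simp: a_def)
      then show "f (n - 1 - l) = M $$ (k, l) * jacobi_trudi_mat n mu t $$ (j, l)"
        using k j l by (simp add: f_def M_def jacobi_trudi_mat_def)
    qed simp
    finally show "?A $$ (k, j) = (M * transpose_mat (jacobi_trudi_mat n mu t)) $$ (k, j)"
      using k j by (simp add: a_def scalar_prod_def M_def jacobi_trudi_mat_def atLeast0LessThan)
  qed (auto simp: M_def jacobi_trudi_mat_def)
  have J: "jacobi_trudi_mat n mu t \<in> carrier_mat n n" for mu
    by (simp add: jacobi_trudi_mat_def)
  have alt: "det (mat n n (\<lambda>(i, j). x i ^ (part mu (j + 1) + (n - 1 - j)))) = det M * schur mu t"
    if "length mu \<le> n" for mu
    unfolding key using that J[of mu]
    by (subst det_mult[of _ n]) (auto simp: M_def det_transpose schur_padding)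
  have "schur [] t = 1" by (simp add: schur_def jacobi_trudi_mat_def)
  moreover have "part [] j = 0" for j by (simp add: part_def)
  ultimately show ?thesis
    using alt[of "[]"] alt[OF assms] by (simp add: t_def mult.commute)
qed


section \<open>The measures, given by their mass functions\<close>

definition schur_measure :: "nat list \<Rightarrow> (nat \<Rightarrow> real) \<Rightarrow> (nat \<Rightarrow> real) \<Rightarrow> real" where
  "schur_measure lam t t' =
     schur lam t * schur lam t' / (\<Sum>\<^sub>\<infinity>mu\<in>int_partitions. schur mu t * schur mu t')"

definition macmahon :: "real \<Rightarrow> real \<Rightarrow> real" where
  "macmahon \<xi> q = (\<Prod>n. inverse ((1 - \<xi>\<^sup>2 * q ^ Suc n) ^ Suc n))"

definition qPP_S :: "nat list \<Rightarrow> real \<Rightarrow> real \<Rightarrow> real" where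
  "qPP_S lam \<xi> q = inverse (macmahon \<xi> q) * (\<xi>\<^sup>2 * q) ^ sum_list lam * q ^ (2 * b_stat lam) *
     (\<Prod>c\<in>diagram lam. 1 / (1 - q ^ hook lam c)\<^sup>2)"

text \<open>The normalization is the one that makes the total mass \<open>1\<close>: for \<open>0 < q\<close> it equals
  \<open>exp (\<xi>\<^sup>2 q\<^bsup>-1/2\<^esup> / (q\<^bsup>1/2\<^esup> - q\<^bsup>-1/2\<^esup>))\<close>. The prefactor
  \<open>exp (\<xi>\<^sup>2 / (q\<^bsup>1/2\<^esup> - q\<^bsup>-1/2\<^esup>))\<close> from the literature lacks the factor \<open>q\<^bsup>-1/2\<^esup>\<close>
  in the exponent and does not normalize these weights: the weight of one-box partitions is
  \<open>\<xi>\<^sup>2 / (1 - q)\<close>.\<close>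

definition qPP_M :: "nat list \<Rightarrow> real \<Rightarrow> real \<Rightarrow> real" where
  "qPP_M lam \<xi> q = exp (- \<xi>\<^sup>2 / (1 - q)) * \<xi> ^ (2 * sum_list lam) * q ^ b_stat lam *
     (\<Prod>c\<in>diagram lam. 1 / (real (hook lam c) * (1 - q ^ hook lam c)))"

text \<open>The two specializations; only indices \<open>n \<ge> 1\<close> matter. At \<open>q = 0\<close> the conventions
  \<open>0 powr a = 0\<close> and \<open>x / 0 = 0\<close> give \<open>q_times \<xi> 0 n = 0\<close>, which is also the limit for
  \<open>q \<rightarrow> 0\<close>. In contrast \<open>exp_times \<xi> q\<close> is meaningful only for \<open>0 < q\<close>.\<close>

definition q_times :: "real \<Rightarrow> real \<Rightarrow> nat \<Rightarrow> real" where
  "q_times \<xi> q n = - (\<xi> ^ n / (real n * (q powr (real n / 2) - q powr (- real n / 2))))"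

definition exp_times :: "real \<Rightarrow> real \<Rightarrow> nat \<Rightarrow> real" where
  "exp_times \<xi> q n = \<xi> * q powr (- 1 / 2) * (if n = 1 then 1 else 0)"

end

theory Submission
  imports Defs
begin

text \<open>Both specializations are evaluated through the Jacobi--Trudi determinant. For
  \<open>t\<^sub>k = 1 / (k (1 - q\<^sup>k))\<close> one has \<open>h\<^sub>k = 1 / (q; q)\<^sub>k\<close>, so the determinant is a Vandermonde
  determinant in \<open>q\<close> to the powers \<open>\<lambda>\<^sub>i + n - i\<close>, and the hook lengths appear because those of row
  \<open>i\<close> together with the differences of these exponents fill an interval. The exponential
  specialization is the limit \<open>p \<rightarrow> 1\<close> of the geometric one with variables \<open>(1 - p) p\<^sup>i\<close>.

  The partition function is computed one degree at a time: for finitely many distinct variables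
  the Cauchy identity follows from Cauchy--Binet and the Cauchy determinant over formal power
  series, and the sum over partitions of a fixed size is finite, hence passes to both limits. All
  terms are nonnegative, so the degrees can then be added up.\<close>

section \<open>Complete homogeneous functions of the variables \<open>t\<close>\<close>

text \<open>The times \<open>k * t k * t' k\<close> recur because \<open>complete_hom\<close> at
  them is read off from exp (sum k t_k t'_k z^k): its value at N is the degree N part of the Cauchy
  product, and its series is the normalization. Fixing the degree avoids exchanging limits with an
  infinite sum, since each statement then involves only polynomials in finitely many t_k. The
  geometric variables q^i are distinct, so Vandermonde products can be cancelled without a density
  argument. In the Cauchy determinant a formal variable X attached to the x_i makes 1 - x_i y_j X
  invertible and records the degree at the same time. The mixed case at q = 0 has to be a limit:
  \<open>exp_times\<close> carries q^(-1/2), which only the factor q^(1/2) of \<open>q_times\<close>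
  compensates.\<close>

lemma complete_hom_cong:
  assumes "\<And>k. k \<ge> 1 \<Longrightarrow> t k = t' k"
  shows "complete_hom t = complete_hom t'"
proof -
  have "(\<lambda>n. if n = 0 then 0 else t n) = (\<lambda>n. if n = 0 then 0 else t' n)"
    using assms by (auto simp: fun_eq_iff)
  then show ?thesis by (simp add: complete_hom_def fun_eq_iff)
qed

lemma Abs_fps_complete_hom:
  "Abs_fps (complete_hom t) = fps_exp 1 oo Abs_fps (\<lambda>n. if n = 0 then 0 else t n)"
  by (simp add: fps_eq_iff complete_hom_def)

lemma complete_hom_0 [simp]: "complete_hom t 0 = 1"
  by (simp add: complete_hom_def fps_compose_nth_0)

text \<open>Newton's identity, by comparing coefficients in H' = T' H for H = exp T. It determines
  h_n from t_1, ..., t_n, which drives the inductions on scaling, monotonicity and limits.\<close>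

lemma complete_hom_rec:
  "real (Suc n) * complete_hom t (Suc n)
    = (\<Sum>i\<le>n. real (Suc i) * t (Suc i) * complete_hom t (n - i))"
proof -
  define T where "T = Abs_fps (\<lambda>n. if n = 0 then 0 else t n)"
  define H where "H = fps_exp 1 oo T"
  have T0: "fps_nth T 0 = 0" by (simp add: T_def)
  have "fps_deriv H = fps_deriv T * H"
    using fps_compose_deriv[OF T0, of "fps_exp 1"] by (simp add: H_def)
  then have "fps_nth (fps_deriv H) n = (\<Sum>i=0..n. fps_nth (fps_deriv T) i * fps_nth H (n - i))"
    by (simp add: fps_mult_nth)
  then show ?thesis
    by (simp add: complete_hom_def flip: T_def H_def) (simp add: T_def atMost_atLeast0)
qed

lemma complete_hom_Suc:
  "complete_hom t (Suc n) = (\<Sum>i\<le>n. real (Suc i) * t (Suc i) * complete_hom t (n - i)) / real (Suc n)"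
  using complete_hom_rec[of n t] by (simp add: field_simps)

lemma complete_hom_scale: "complete_hom (\<lambda>k. c ^ k * t k) n = c ^ n * complete_hom t n"
proof (induction n rule: less_induct)
  case (less n)
  show ?case
  proof (cases n)
    case (Suc m)
    have "(\<Sum>i\<le>m. real (Suc i) * (c ^ Suc i * t (Suc i)) * complete_hom (\<lambda>k. c ^ k * t k) (m - i))
        = (\<Sum>i\<le>m. c ^ Suc m * (real (Suc i) * t (Suc i) * complete_hom t (m - i)))"
    proof (rule sum.cong)
      fix i assume i: "i \<in> {..m}"
      have "c ^ Suc m = c ^ Suc i * c ^ (m - i)"
        using i by (simp flip: power_add power_Suc)
      moreover have "complete_hom (\<lambda>k. c ^ k * t k) (m - i) = c ^ (m - i) * complete_hom t (m - i)"
        using less.IH[of "m - i"] Suc by simp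
      ultimately show "real (Suc i) * (c ^ Suc i * t (Suc i)) * complete_hom (\<lambda>k. c ^ k * t k) (m - i)
          = c ^ Suc m * (real (Suc i) * t (Suc i) * complete_hom t (m - i))"
        by (simp only: ac_simps)
    qed simp
    then show ?thesis unfolding Suc complete_hom_Suc by (simp flip: sum_distrib_left)
  qed simp
qed

text \<open>The recursion has nonnegative coefficients when the t_k are nonnegative. This order
  later permits comparing the MacMahon series with truncations from below.\<close>

lemma complete_hom_mono:
  assumes "\<And>k. k \<ge> 1 \<Longrightarrow> 0 \<le> t k" "\<And>k. k \<ge> 1 \<Longrightarrow> t k \<le> t' k"
  shows "0 \<le> complete_hom t n \<and> complete_hom t n \<le> complete_hom t' n"
proof (induction n rule: less_induct)
  case (less n)
  show ?case
  proof (cases n)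
    case (Suc m)
    have "0 \<le> complete_hom t (Suc m)"
      unfolding complete_hom_Suc
      by (intro divide_nonneg_nonneg sum_nonneg mult_nonneg_nonneg)
         (use less.IH Suc assms in auto)
    moreover have "complete_hom t (Suc m) \<le> complete_hom t' (Suc m)"
      unfolding complete_hom_Suc
    proof (intro divide_right_mono sum_mono mult_mono)
      fix i assume "i \<in> {..m}"
      show "0 \<le> real (Suc i) * t' (Suc i)"
        using assms[of "Suc i"] by (intro mult_nonneg_nonneg) auto
    qed (use less.IH Suc assms in auto)
    ultimately show ?thesis by (simp add: Suc)
  qed simp
qed

lemma tendsto_complete_hom:
  assumes "\<And>k. k \<ge> 1 \<Longrightarrow> ((\<lambda>z. t z k) \<longlongrightarrow> t' k) F"
  shows "((\<lambda>z. complete_hom (t z) n) \<longlongrightarrow> complete_hom t' n) F"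
proof (induction n rule: less_induct)
  case (less n)
  show ?case
  proof (cases n)
    case (Suc m)
    show ?thesis
      unfolding Suc complete_hom_Suc by (intro tendsto_intros assms less.IH) (auto simp: Suc)
  qed simp
qed

text \<open>This is exp (S + T) = exp S * exp T over formal power series, the union of two sets of
  variables. The product of exp S, exp T and exp (- S - T) has zero derivative and constant term
  1.\<close>

lemma complete_hom_add:
  "Abs_fps (complete_hom (\<lambda>k. s k + t k)) = Abs_fps (complete_hom s) * Abs_fps (complete_hom t)"
proof -
  define U where "U = (\<lambda>u :: nat \<Rightarrow> real. Abs_fps (\<lambda>n. if n = 0 then 0 else u n))"
  define H where "H = (\<lambda>u. fps_exp (1 :: real) oo U u)"
  have U0: "fps_nth (U u) 0 = 0" for u by (simp add: U_def)
  have dH: "fps_deriv (H u) = H u * fps_deriv (U u)" for u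
    using fps_compose_deriv[OF U0, of "fps_exp 1"] by (simp add: H_def)
  have H0: "fps_nth (H u) 0 = 1" for u by (simp add: H_def fps_compose_nth_0)
  have inv: "H u * H (\<lambda>k. - u k) = 1" for u
  proof -
    have "fps_deriv (U (\<lambda>k. - u k)) = - fps_deriv (U u)"
      by (simp add: U_def fps_eq_iff)
    then have "fps_deriv (H u * H (\<lambda>k. - u k)) = 0"
      by (simp add: dH algebra_simps)
    then have "H u * H (\<lambda>k. - u k) = fps_const (fps_nth (H u * H (\<lambda>k. - u k)) 0)"
      by (simp only: fps_deriv_eq_0_iff)
    then show ?thesis by (simp add: H0)
  qed
  define V where "V = (\<lambda>k. s k + t k)"
  define W where "W = H (\<lambda>k. - V k)"
  have "fps_deriv (U (\<lambda>k. - V k)) = - fps_deriv (U s) - fps_deriv (U t)"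
    by (simp add: U_def V_def fps_eq_iff algebra_simps)
  then have dW: "fps_deriv W = - W * (fps_deriv (U s) + fps_deriv (U t))"
    unfolding W_def dH by (simp only:) (simp add: algebra_simps)
  have "fps_deriv (H s * H t * W) = 0"
    unfolding fps_deriv_mult dW dH by (simp add: algebra_simps)
  then have "H s * H t * W = fps_const (fps_nth (H s * H t * W) 0)"
    by (simp only: fps_deriv_eq_0_iff)
  then have "H s * H t * W = 1" by (simp add: H0 W_def)
  then have "H V = H V * (H s * H t * W)" by simp
  also have "\<dots> = (H V * W) * (H s * H t)" by (simp only: ac_simps)
  also have "\<dots> = H s * H t" by (simp add: inv W_def)
  finally show ?thesis by (simp add: Abs_fps_complete_hom H_def U_def V_def)
qed

lemma complete_hom_single: "complete_hom (\<lambda>k. c ^ k / real k) = (\<lambda>n. c ^ n)"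
proof -
  let ?L = "1 - fps_const c * fps_X"
  have "Abs_fps (complete_hom (\<lambda>k. c ^ k / real k)) * ?L = 1"
    using complete_hom_power_sums[of "\<lambda>_. c" 1] by simp
  moreover have "Abs_fps (\<lambda>n. c ^ n) * ?L = 1"
  proof (rule fps_ext)
    fix m show "fps_nth (Abs_fps (\<lambda>n. c ^ n) * ?L) m = fps_nth 1 m"
      by (cases m) (simp_all add: fps_mult_linear_nth)
  qed
  ultimately have "Abs_fps (complete_hom (\<lambda>k. c ^ k / real k)) = Abs_fps (\<lambda>n. c ^ n)"
    by (metis mult_right_cancel mult_zero_right zero_neq_one)
  then show ?thesis by (simp add: fps_eq_iff fun_eq_iff)
qed

lemma complete_hom_zero: "complete_hom (\<lambda>k. 0) n = (if n = 0 then 1 else 0)"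
  by (cases n) (simp_all add: complete_hom_Suc)

text \<open>Extends \<open>complete_hom_power_sums\<close> to an arbitrary finite index set; the
  Cauchy identity uses it with pairs (i, j).\<close>

lemma complete_hom_sum_power_sums:
  assumes "finite A"
  shows "Abs_fps (complete_hom (\<lambda>k. (\<Sum>i\<in>A. x i ^ k) / real k)) * (\<Prod>i\<in>A. 1 - fps_const (x i) * fps_X) = 1"
  using assms
proof (induction A rule: finite_induct)
  case empty
  show ?case by (simp add: complete_hom_zero fps_eq_iff)
next
  case (insert a A)
  have *: "(\<lambda>k. (\<Sum>i\<in>insert a A. x i ^ k) / real k) = (\<lambda>k. x a ^ k / real k + (\<Sum>i\<in>A. x i ^ k) / real k)"
    using insert by (simp add: add_divide_distrib)
  have "Abs_fps (complete_hom (\<lambda>k. x a ^ k / real k)) * (1 - fps_const (x a) * fps_X) = 1"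
    using complete_hom_power_sums[of "\<lambda>_. x a" 1] by simp
  then show ?case using insert unfolding * complete_hom_add
    by (simp add: ac_simps)
qed

text \<open>The generating product is evaluated at z = 1. Each new variable contributes a geometric
  series, multiplied in as a Cauchy product of absolutely convergent series.\<close>

lemma complete_hom_sum_power_sums_sums:
  fixes x :: "'a \<Rightarrow> real"
  assumes "finite A" "\<And>i. i \<in> A \<Longrightarrow> 0 \<le> x i \<and> x i < 1"
  shows "complete_hom (\<lambda>k. (\<Sum>i\<in>A. x i ^ k) / real k) sums (\<Prod>i\<in>A. inverse (1 - x i))"
  using assms
proof (induction A rule: finite_induct)
  case empty
  have "(\<lambda>n. if n = 0 then 1 else 0 :: real) sums 1" using sums_single[of 0 "\<lambda>_. 1 :: real"] by simp
  then show ?case by (simp add: complete_hom_zero[abs_def])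
next
  case (insert a A)
  let ?t = "\<lambda>k. (\<Sum>i\<in>A. x i ^ k) / real k"
  have *: "(\<lambda>k. (\<Sum>i\<in>insert a A. x i ^ k) / real k) = (\<lambda>k. x a ^ k / real k + ?t k)"
    using insert by (simp add: add_divide_distrib)
  have h: "complete_hom (\<lambda>k. (\<Sum>i\<in>insert a A. x i ^ k) / real k) n
      = (\<Sum>i\<le>n. x a ^ i * complete_hom ?t (n - i))" for n
    using arg_cong[OF complete_hom_add[of "\<lambda>k. x a ^ k / real k" ?t], of "\<lambda>f. fps_nth f n"]
    unfolding * by (simp add: fps_mult_nth complete_hom_single atMost_atLeast0)
  have s1: "(\<lambda>n. x a ^ n) sums (1 / (1 - x a))" using insert.prems[of a] by (intro geometric_sums) auto
  have s2: "complete_hom ?t sums (\<Prod>i\<in>A. inverse (1 - x i))" using insert by auto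
  have nn: "0 \<le> complete_hom ?t n" for n
    using insert.prems by (intro conjunct1[OF complete_hom_mono[where t' = ?t]] divide_nonneg_nonneg sum_nonneg) auto
  have "(\<lambda>n. \<Sum>i\<le>n. x a ^ i * complete_hom ?t (n - i)) sums ((\<Sum>n. x a ^ n) * (\<Sum>n. complete_hom ?t n))"
    using s1 s2 insert.prems[of a] nn
    by (intro Cauchy_product_sums) (auto simp: sums_iff)
  moreover have "(\<Sum>n. x a ^ n) * (\<Sum>n. complete_hom ?t n) = (\<Prod>i\<in>insert a A. inverse (1 - x i))"
    using s1 s2 insert by (simp add: sums_iff divide_inverse)
  ultimately show ?case by (simp add: h[abs_def])
qed

text \<open>The times are those of 1, q, q^2, and so on. Removing the variable 1 rescales the rest
  by q, so H(z) (1 - z) = H(q z); comparing coefficients gives h_n (1 - q^n) = h_(n-1).\<close>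

lemma complete_hom_geometric:
  fixes q :: real
  assumes "0 < q" "q < 1"
  shows "complete_hom (\<lambda>k. 1 / (real k * (1 - q ^ k))) n = 1 / (\<Prod>r = 1..n. 1 - q ^ r)"
proof (induction n)
  case (Suc n)
  let ?t = "\<lambda>k. 1 / (real k * (1 - q ^ k))"
  have ne: "1 - q ^ k \<noteq> 0" if "k \<ge> 1" for k
    using power_strict_decreasing[of 0 k q] that assms by simp
  have "complete_hom ?t = complete_hom (\<lambda>k. 1 ^ k / real k + q ^ k * ?t k)"
    by (rule complete_hom_cong) (use ne in \<open>auto simp: field_simps\<close>)
  then have "Abs_fps (complete_hom ?t) = Abs_fps (\<lambda>n. 1) * Abs_fps (\<lambda>n. q ^ n * complete_hom ?t n)"
    using complete_hom_add[of "\<lambda>k. 1 ^ k / real k" "\<lambda>k. q ^ k * ?t k"] complete_hom_single[of 1]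
      complete_hom_scale[of q ?t, abs_def] by simp
  moreover have "Abs_fps (\<lambda>n. 1 :: real) * (1 - fps_const 1 * fps_X) = 1"
  proof (rule fps_ext)
    fix m show "fps_nth (Abs_fps (\<lambda>n. 1 :: real) * (1 - fps_const 1 * fps_X)) m = fps_nth 1 m"
      by (cases m) (simp_all only: fps_mult_linear_nth, simp_all)
  qed
  ultimately have "Abs_fps (complete_hom ?t) * (1 - fps_const 1 * fps_X) = Abs_fps (\<lambda>n. q ^ n * complete_hom ?t n)"
    by (metis (no_types, lifting) mult.assoc mult.commute mult_1)
  then have "fps_nth (Abs_fps (complete_hom ?t) * (1 - fps_const 1 * fps_X)) (Suc n)
      = q ^ Suc n * complete_hom ?t (Suc n)"
    by simp
  then have "complete_hom ?t (Suc n) * (1 - q ^ Suc n) = complete_hom ?t n"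
    by (simp only: fps_mult_linear_nth) (simp add: algebra_simps)
  then have "complete_hom ?t (Suc n) = complete_hom ?t n / (1 - q ^ Suc n)"
    using ne[of "Suc n"] by (simp add: field_simps)
  then show ?case by (simp add: Suc)
qed simp

section \<open>Determinants of polynomial evaluations\<close>

text \<open>The evaluation matrix is the Vandermonde matrix times the matrix of coefficients.
  Listing powers in decreasing order makes the latter lower triangular, with diagonal entries
  \<open>coeff (P j) (n - 1 - j)\<close>.\<close>

lemma det_poly_eval_eq_vandermonde:
  fixes P :: "nat \<Rightarrow> 'a :: idom poly"
  assumes "\<And>j. j < n \<Longrightarrow> degree (P j) \<le> n - 1 - j"
  shows "det (mat n n (\<lambda>(i, j). poly (P j) (u i)))
    = det (mat n n (\<lambda>(i, j). u i ^ (n - 1 - j))) * (\<Prod>j<n. coeff (P j) (n - 1 - j))"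
proof -
  define V where "V = mat n n (\<lambda>(i, j). u i ^ (n - 1 - j))"
  define T where "T = mat n n (\<lambda>(k, j). coeff (P j) (n - 1 - k))"
  have "mat n n (\<lambda>(i, j). poly (P j) (u i)) = V * T"
  proof (rule eq_matI)
    fix i j assume "i < dim_row (V * T)" "j < dim_col (V * T)"
    then have i: "i < n" and j: "j < n" by (auto simp: V_def T_def)
    have "poly (P j) (u i) = (\<Sum>r\<le>degree (P j). coeff (P j) r * u i ^ r)"
      by (rule poly_altdef)
    also have "\<dots> = (\<Sum>r<n. coeff (P j) r * u i ^ r)"
      using assms[OF j] j by (intro sum.mono_neutral_left) (auto simp: coeff_eq_0)
    also have "\<dots> = (\<Sum>k<n. u i ^ (n - 1 - k) * coeff (P j) (n - 1 - k))"
      by (rule sum.reindex_bij_witness[of _ "\<lambda>l. n - 1 - l" "\<lambda>l. n - 1 - l"]) auto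
    finally show "mat n n (\<lambda>(i, j). poly (P j) (u i)) $$ (i, j) = (V * T) $$ (i, j)"
      using i j by (simp add: V_def T_def scalar_prod_def atLeast0LessThan)
  qed (auto simp: V_def T_def)
  moreover have "det T = (\<Prod>j<n. coeff (P j) (n - 1 - j))"
  proof -
    have "T $$ (i, j) = 0" if "i < j" "j < n" for i j
      using that assms[of j] by (auto simp: T_def intro!: coeff_eq_0)
    then have "det T = prod_list (diag_mat T)"
      by (rule det_lower_triangular) (auto simp: T_def)
    then show ?thesis by (simp add: prod_list_diag_prod T_def atLeast0LessThan)
  qed
  ultimately show ?thesis
    using det_mult[of V n T] by (simp add: V_def T_def)
qed

text \<open>In the Newton basis \<open>\<Prod>\<^sub>r\<^sub>>\<^sub>j (X - u\<^sub>r)\<close> the evaluation matrix is triangular.\<close>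

lemma det_vandermonde:
  fixes u :: "nat \<Rightarrow> 'a :: idom"
  shows "det (mat n n (\<lambda>(i, j). u i ^ (n - 1 - j))) = (\<Prod>j<n. \<Prod>r\<in>{j<..<n}. u j - u r)"
proof -
  define P where "P = (\<lambda>j. \<Prod>r\<in>{j<..<n}. [:- u r, 1:])"
  define A where "A = mat n n (\<lambda>(i, j). poly (P j) (u i))"
  have deg: "degree (P j) = n - 1 - j" for j
    unfolding P_def by (subst degree_prod_eq_sum_degree) auto
  have "coeff (P j) (n - 1 - j) = lead_coeff (P j)" for j by (simp add: deg)
  also have "\<dots> j = 1" for j by (simp add: P_def lead_coeff_prod)
  finally have lc: "coeff (P j) (n - 1 - j) = 1" for j .
  have "det A = det (mat n n (\<lambda>(i, j). u i ^ (n - 1 - j)))"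
    unfolding A_def by (subst det_poly_eval_eq_vandermonde) (simp_all only: deg lc prod.neutral_const mult_1_right order.refl)
  moreover have "A $$ (i, j) = 0" if "j < i" "i < n" for i j
    using that by (auto simp: A_def P_def poly_prod intro!: bexI[of _ i])
  then have "det A = prod_list (diag_mat A)"
    by (intro det_upper_triangular[of _ n] upper_triangularI) (auto simp: A_def)
  ultimately show ?thesis
    by (simp add: prod_list_diag_prod A_def P_def poly_prod atLeast0LessThan)
qed

lemma det_poly_eval:
  fixes P :: "nat \<Rightarrow> 'a :: idom poly"
  assumes "\<And>j. j < n \<Longrightarrow> degree (P j) \<le> n - 1 - j"
  shows "det (mat n n (\<lambda>(i, j). poly (P j) (u i)))
    = (\<Prod>j<n. \<Prod>r\<in>{j<..<n}. u j - u r) * (\<Prod>j<n. coeff (P j) (n - 1 - j))"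
  unfolding det_vandermonde[symmetric] by (rule det_poly_eval_eq_vandermonde) (rule assms)


section \<open>Partitions and hooks\<close>

lemma part_antimono:
  assumes "lam \<in> int_partitions" "1 \<le> i" "i \<le> j"
  shows "part lam j \<le> part lam i"
proof (cases "j \<le> length lam \<and> i < j")
  case True
  have "sorted_wrt (\<ge>) lam" using assms by (simp add: int_partitions_def)
  then have "lam ! (j - 1) \<le> lam ! (i - 1)"
    using True assms by (intro sorted_wrt_nth_less[of "(\<ge>)" lam]) auto
  then show ?thesis using True assms by (simp add: part_def)
qed (use assms in \<open>auto simp: part_def\<close>)

lemma part_pos:
  assumes "lam \<in> int_partitions" "1 \<le> i" "i \<le> length lam"
  shows "0 < part lam i"
  using assms by (auto simp: part_def int_partitions_def)

lemma diagram_eq: "diagram lam = (SIGMA i:{1..length lam}. {1..part lam i})"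
  by (auto simp: diagram_def part_def split: if_splits)

lemma finite_diagram [simp]: "finite (diagram lam)"
  by (simp add: diagram_eq)

lemma sum_list_eq_sum_part: "sum_list lam = (\<Sum>i<length lam. part lam (i + 1))"
  by (simp add: sum_list_sum_nth part_def atLeast0LessThan)

lemma card_diagram: "card (diagram lam) = sum_list lam"
proof -
  have "card (diagram lam) = (\<Sum>i\<in>{1..length lam}. part lam i)"
    by (simp add: diagram_eq)
  also have "\<dots> = (\<Sum>i<length lam. part lam (i + 1))"
    by (rule sum.reindex_bij_witness[of _ "\<lambda>i. i + 1" "\<lambda>i. i - 1"]) auto
  finally show ?thesis by (simp add: sum_list_eq_sum_part)
qed

text \<open>Parts decrease weakly, so the rows that meet column j form an initial segment, and its
  cardinality \<open>conj_part lam j\<close> decides membership.\<close>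

lemma le_part_iff_le_conj_part:
  assumes "lam \<in> int_partitions" "1 \<le> i" "1 \<le> j"
  shows "j \<le> part lam i \<longleftrightarrow> i \<le> conj_part lam j"
proof -
  let ?S = "{i. 1 \<le> i \<and> i \<le> length lam \<and> j \<le> part lam i}"
  have fin: "finite ?S" by (rule finite_subset[of _ "{1..length lam}"]) auto
  show ?thesis
  proof
    assume "j \<le> part lam i"
    then have "{1..i} \<subseteq> ?S"
      using assms part_antimono[OF assms(1), of _ i] by (force simp: part_def split: if_splits)
    then show "i \<le> conj_part lam j"
      using card_mono[OF fin, of "{1..i}"] by (simp add: conj_part_def)
  next
    assume *: "i \<le> conj_part lam j"
    show "j \<le> part lam i"
    proof (rule ccontr)
      assume "\<not> j \<le> part lam i"
      then have "?S \<subseteq> {1..<i}"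
        using assms part_antimono[OF assms(1), of i] by (force simp: not_le)
      then have "card ?S \<le> i - 1" using card_mono[of "{1..<i}" ?S] by simp
      then show False using * assms by (simp add: conj_part_def)
    qed
  qed
qed

lemma conj_part_le_length: "conj_part lam j \<le> length lam"
proof -
  have "card {i. 1 \<le> i \<and> i \<le> length lam \<and> j \<le> part lam i} \<le> card {1..length lam}"
    by (intro card_mono) auto
  then show ?thesis by (simp add: conj_part_def)
qed

lemma hook_pos:
  assumes "lam \<in> int_partitions" "c \<in> diagram lam"
  shows "0 < hook lam c"
  using assms le_part_iff_le_conj_part[of lam "fst c" "snd c"]
  by (auto simp: diagram_def hook_def split: prod.splits)

text \<open>The beta numbers of a partition, with rows counted from 0: the added staircase turns
  weakly decreasing parts into the distinct exponents of an alternant.\<close>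

definition shifted_part :: "nat \<Rightarrow> nat list \<Rightarrow> nat \<Rightarrow> nat" where
  "shifted_part n lam i = part lam (i + 1) + (n - 1 - i)"

lemma shifted_part_less:
  assumes "lam \<in> int_partitions" "i < j" "j < n"
  shows "shifted_part n lam j < shifted_part n lam i"
  using part_antimono[OF assms(1), of "i + 1" "j + 1"] assms by (simp add: shifted_part_def)

text \<open>Hooks strictly decrease along the row and the differences strictly increase with j, so
  both families are injective. They are disjoint, and their numbers \<open>part lam (i + 1)\<close>
  and \<open>n - 1 - i\<close> add up to \<open>l i\<close>.\<close>

lemma hooks_of_row:
  assumes lam: "lam \<in> int_partitions" and i: "i < length lam"
  defines "n \<equiv> length lam"
  defines "l \<equiv> shifted_part n lam"
  shows "(\<Prod>r = 1..l i. f r)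
    = (\<Prod>j = 1..part lam (i + 1). f (hook lam (i + 1, j))) * (\<Prod>j\<in>{i<..<n}. f (l i - l j))"
proof -
  define h where "h = (\<lambda>j. hook lam (i + 1, j))"
  define g where "g = (\<lambda>j. l i - l j)"
  let ?J = "{1..part lam (i + 1)}" and ?R = "{i<..<n}"
  have conj: "r < conj_part lam j \<longleftrightarrow> j \<le> part lam (r + 1)" if "1 \<le> j" for r j
    using le_part_iff_le_conj_part[OF lam, of "r + 1" j] that by auto
  have ci: "i + 1 \<le> conj_part lam j" if "j \<in> ?J" for j
    using conj[of j i] that by auto
  have cn: "conj_part lam j \<le> n" for j
    using conj_part_le_length[of lam j] by (simp add: n_def)
  have canti: "conj_part lam j' \<le> conj_part lam j" if "1 \<le> j" "j \<le> j'" for j j'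
  proof (rule ccontr)
    assume "\<not> ?thesis"
    then show False using conj[of j "conj_part lam j"] conj[of j' "conj_part lam j"] that by auto
  qed
  have h_eq: "h j + i + j = part lam (i + 1) + conj_part lam j" if "j \<in> ?J" for j
    using ci[OF that] that by (simp add: h_def hook_def)
  have g_eq: "g r + i + part lam (r + 1) = part lam (i + 1) + r" if "r \<in> ?R" for r
    using shifted_part_less[OF lam, of i r n] that by (auto simp: g_def l_def shifted_part_def)
  have l_eq: "l i + i + 1 = part lam (i + 1) + n"
    using i by (simp add: l_def shifted_part_def n_def)
  have injh: "inj_on h ?J"
  proof (rule linorder_inj_onI')
    fix j j' assume "j \<in> ?J" "j' \<in> ?J" "j < j'"
    then show "h j \<noteq> h j'" using h_eq[of j] h_eq[of j'] canti[of j j'] by auto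
  qed
  have injg: "inj_on g ?R"
  proof (rule linorder_inj_onI')
    fix r r' assume "r \<in> ?R" "r' \<in> ?R" "r < r'"
    then show "g r \<noteq> g r'"
      using g_eq[of r] g_eq[of r'] part_antimono[OF lam, of "r + 1" "r' + 1"] by auto
  qed
  \<comment> \<open>Equality would force \<open>conj_part lam j + part lam (r + 1) = r + j\<close>.
    If row \<open>r + 1\<close> reaches column \<open>j\<close>, the left side is larger; otherwise
    it is smaller.\<close>
  have disj: "h ` ?J \<inter> g ` ?R = {}"
  proof -
    have "h j \<noteq> g r" if "j \<in> ?J" "r \<in> ?R" for j r
      using h_eq[OF that(1)] g_eq[OF that(2)] conj[of j r] that by (cases "r < conj_part lam j") auto
    then show ?thesis by blast
  qed
  have "h ` ?J \<union> g ` ?R = {1..l i}"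
  proof (rule card_subset_eq)
    have "h j \<in> {1..l i}" if "j \<in> ?J" for j
      using h_eq[OF that] ci[OF that] cn[of j] l_eq that by auto
    moreover have "g r \<in> {1..l i}" if "r \<in> ?R" for r
      using g_eq[OF that] l_eq that part_antimono[OF lam, of "i + 1" "r + 1"] by auto
    ultimately show "h ` ?J \<union> g ` ?R \<subseteq> {1..l i}" by blast
    show "card (h ` ?J \<union> g ` ?R) = card {1..l i}"
      using disj l_eq i card_image[OF injh] card_image[OF injg] by (simp add: card_Un_disjoint n_def)
  qed simp
  then have "(\<Prod>r = 1..l i. f r) = (\<Prod>r\<in>h ` ?J \<union> g ` ?R. f r)" by simp
  also have "\<dots> = (\<Prod>j\<in>?J. f (h j)) * (\<Prod>r\<in>?R. f (g r))"
    by (subst prod.union_disjoint[OF _ _ disj]) (simp_all only: prod.reindex[OF injh] prod.reindex[OF injg] o_def finite_imageI finite_atLeastAtMost finite_greaterThanLessThan)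
  finally show ?thesis by (simp add: h_def g_def)
qed

lemma prod_hooks:
  assumes lam: "lam \<in> int_partitions"
  defines "n \<equiv> length lam"
  defines "l \<equiv> shifted_part n lam"
  shows "(\<Prod>i<n. \<Prod>r = 1..l i. f r)
    = (\<Prod>c\<in>diagram lam. f (hook lam c)) * (\<Prod>i<n. \<Prod>j\<in>{i<..<n}. f (l i - l j))"
proof -
  have "(\<Prod>c\<in>diagram lam. f (hook lam c)) = (\<Prod>i\<in>{1..n}. \<Prod>j = 1..part lam i. f (hook lam (i, j)))"
    unfolding diagram_eq n_def by (subst prod.Sigma) (auto simp: case_prod_beta)
  also have "\<dots> = (\<Prod>i<n. \<Prod>j = 1..part lam (i + 1). f (hook lam (i + 1, j)))"
    by (rule prod.reindex_bij_witness[of _ "\<lambda>i. i + 1" "\<lambda>i. i - 1"]) auto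
  finally show ?thesis
    using hooks_of_row[OF lam, of _ f] by (simp add: n_def l_def flip: prod.distrib)
qed

section \<open>The principal specialization\<close>

text \<open>In each Leibniz term the index shifts p(i) - i cancel, leaving total degree |\<lambda>|.
  A term with a negative index is zero on both sides.\<close>

lemma schur_scale: "schur lam (\<lambda>k. c ^ k * t k) = c ^ sum_list lam * schur lam t"
proof -
  define n where "n = length lam"
  let ?J = "\<lambda>t. jacobi_trudi_mat n lam t"
  have J: "?J t \<in> carrier_mat n n" for t by (simp add: jacobi_trudi_mat_def)
  have "(\<Prod>i = 0..<n. ?J (\<lambda>k. c ^ k * t k) $$ (i, p i))
      = c ^ sum_list lam * (\<Prod>i = 0..<n. ?J t $$ (i, p i))" (is "?L = ?R")
    if p: "p permutes {0..<n}" for p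
  proof (cases "\<forall>i<n. i \<le> part lam (i + 1) + p i")
    case True
    have pn: "p i < n" if "i < n" for i
      using permutes_in_image[OF p, of i] that by simp
    have "?L = (\<Prod>i = 0..<n. c ^ (part lam (i + 1) + p i - i) * ?J t $$ (i, p i))"
      using True pn by (intro prod.cong) (auto simp: jacobi_trudi_mat_def complete_hom_scale)
    also have "\<dots> = c ^ (\<Sum>i = 0..<n. part lam (i + 1) + p i - i) * (\<Prod>i = 0..<n. ?J t $$ (i, p i))"
      by (simp add: prod.distrib power_sum)
    also have "(\<Sum>i = 0..<n. part lam (i + 1) + p i - i) = sum_list lam"
    proof -
      have "(\<Sum>i = 0..<n. part lam (i + 1) + p i - i) + (\<Sum>i = 0..<n. i)
          = (\<Sum>i = 0..<n. part lam (i + 1) + p i)"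
        using True by (simp flip: sum.distrib)
      also have "\<dots> = sum_list lam + (\<Sum>i = 0..<n. i)"
        using sum.permute[OF p, of "\<lambda>i. i"]
        by (simp add: sum.distrib sum_list_eq_sum_part n_def atLeast0LessThan o_def)
      finally show ?thesis by simp
    qed
    finally show ?thesis .
  next
    case False
    then obtain i where "i < n" "\<not> i \<le> part lam (i + 1) + p i" by auto
    moreover from this have "p i < n" using permutes_in_image[OF p, of i] by simp
    ultimately have "?J t $$ (i, p i) = 0" for t by (simp add: jacobi_trudi_mat_def)
    then have "(\<Prod>i = 0..<n. ?J t $$ (i, p i)) = 0" for t using \<open>i < n\<close> by force
    then show ?thesis by (simp only: mult_zero_right)
  qed
  then show ?thesis
    unfolding schur_def n_def[symmetric] det_def'[OF J] sum_distrib_left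
    by (intro sum.cong) (auto simp: algebra_simps)
qed

lemma tendsto_schur:
  assumes "\<And>k. k \<ge> 1 \<Longrightarrow> ((\<lambda>z. t z k) \<longlongrightarrow> t' k) F"
  shows "((\<lambda>z. schur lam (t z)) \<longlongrightarrow> schur lam t') F"
proof -
  define n where "n = length lam"
  have J: "jacobi_trudi_mat n lam t \<in> carrier_mat n n" for t by (simp add: jacobi_trudi_mat_def)
  have "((\<lambda>z. jacobi_trudi_mat n lam (t z) $$ (i, j)) \<longlongrightarrow> jacobi_trudi_mat n lam t' $$ (i, j)) F"
    if "i < n" "j < n" for i j
    using that tendsto_complete_hom[OF assms] by (simp add: jacobi_trudi_mat_def)
  moreover have "p i < n" if "p permutes {0..<n}" "i < n" for p i
    using permutes_in_image[OF that(1), of i] that by simp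
  ultimately show ?thesis
    unfolding schur_def n_def[symmetric] det_def'[OF J]
    by (intro tendsto_sum tendsto_mult tendsto_const tendsto_prod) auto
qed

lemma schur_cong:
  assumes "\<And>k. k \<ge> 1 \<Longrightarrow> t k = t' k"
  shows "schur lam t = schur lam t'"
proof -
  have "complete_hom t = complete_hom t'" by (rule complete_hom_cong) (rule assms)
  then show ?thesis by (simp only: schur_def jacobi_trudi_mat_def)
qed

lemma b_stat_eq: "b_stat lam = (\<Sum>j<length lam. j * part lam (j + 1))"
  unfolding b_stat_def
  by (rule sum.reindex_bij_witness[of _ "\<lambda>i. i + 1" "\<lambda>i. i - 1"]) auto

text \<open>Both sides are n choose 3. In the principal specialization the left exponent comes from
  the staircase in the Vandermonde product, the right one from leading coefficients; their agreement
  leaves exactly q^b(\<lambda>).\<close>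

lemma sum_index_mult_complement: "(\<Sum>j<n. j * (n - 1 - j)) = (\<Sum>m<n. \<Sum>r<m. r :: nat)"
proof (induction n)
  case (Suc n)
  have "j * (n - j) = j * (n - 1 - j) + j" if "j < n" for j
  proof -
    have "n - j = Suc (n - 1 - j)" using that by simp
    then show ?thesis by (simp only: mult_Suc_right add.commute)
  qed
  then have "(\<Sum>j<n. j * (n - j)) = (\<Sum>j<n. j * (n - 1 - j) + j)" by (intro sum.cong) auto
  then have "(\<Sum>j<Suc n. j * (Suc n - 1 - j)) = (\<Sum>j<n. j * (n - 1 - j)) + (\<Sum>j<n. j)"
    by (simp add: sum.distrib)
  then show ?case by (simp only: Suc sum.lessThan_Suc)
qed simp

text \<open>Row \<open>i\<close> of the Jacobi--Trudi matrix is \<open>1 / (q; q)\<^bsub>l\<^sub>i\<^esub>\<close> times values at \<open>q\<^bsup>l\<^sub>i\<^esup>\<close> of polynomials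
  whose degrees do not depend on \<open>i\<close>, so that the determinant becomes a Vandermonde determinant.\<close>

lemma schur_geometric:
  fixes q :: real
  assumes q: "0 < q" "q < 1" and lam: "lam \<in> int_partitions"
  shows "schur lam (\<lambda>k. 1 / (real k * (1 - q ^ k)))
    = q ^ b_stat lam * (\<Prod>c\<in>diagram lam. 1 / (1 - q ^ hook lam c))"
proof -
  define n where "n = length lam"
  define l where "l = shifted_part n lam"
  define t where "t = (\<lambda>k. 1 / (real k * (1 - q ^ k)))"
  define w where "w = (\<lambda>m. \<Prod>r = 1..m. 1 - q ^ r)"
  define P where "P = (\<lambda>j. \<Prod>r<n - 1 - j. [:1, - (1 / q ^ r):])"
  have ne: "1 - q ^ k \<noteq> 0" if "k \<ge> 1" for k
    using power_strict_decreasing[of 0 k q] that q by simp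
  have w: "w m \<noteq> 0" for m using ne by (simp add: w_def)
  have h: "complete_hom t k = 1 / w k" for k
    using complete_hom_geometric[OF q] by (simp add: t_def w_def)
  \<comment> \<open>The factors are 1 - q^(k-r) for r < m, the top m factors of (q; q)_k. When m > k
    the factor with r = k vanishes, which reproduces the zero entries at negative indices.\<close>
  have wdiv: "poly (\<Prod>r<m. [:1, - (1 / q ^ r):]) (q ^ k) = (if m \<le> k then w k / w (k - m) else 0)" for m k
  proof (induction m)
    case 0
    show ?case using w by simp
  next
    case (Suc m)
    have *: "w k / w (k - m) * (1 - q ^ k / q ^ m) = (if Suc m \<le> k then w k / w (k - Suc m) else 0)" if "m \<le> k"
    proof (cases "m = k")
      case True
      then show ?thesis using q by simp
    next
      case False
      with that have km: "k - m = Suc (k - Suc m)" by simp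
      have "w (k - m) = w (k - Suc m) * (1 - q ^ (k - m))" unfolding km by (simp add: w_def)
      moreover have "q ^ (k - m) = q ^ k / q ^ m" using that q by (simp add: power_diff)
      ultimately show ?thesis using False that w[of "k - m"] by simp
    qed
    have "poly (\<Prod>r<Suc m. [:1, - (1 / q ^ r):]) (q ^ k)
        = poly (\<Prod>r<m. [:1, - (1 / q ^ r):]) (q ^ k) * (1 - q ^ k / q ^ m)" by (simp add: algebra_simps)
    then show ?case unfolding Suc using * by (cases "m \<le> k") (simp_all only: if_True if_False mult_zero_left, simp)
  qed
  have entry: "jacobi_trudi_mat n lam t $$ (i, j) = 1 / w (l i) * poly (P j) (q ^ l i)"
    if "i < n" "j < n" for i j
  proof -
    have "n - 1 - j \<le> l i \<longleftrightarrow> i \<le> part lam (i + 1) + j"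
      "i \<le> part lam (i + 1) + j \<Longrightarrow> part lam (i + 1) + j - i = l i - (n - 1 - j)"
      using that by (auto simp: l_def shifted_part_def)
    then show ?thesis using that w by (simp add: P_def wdiv jacobi_trudi_mat_def h)
  qed
  have degP: "degree (P j) = n - 1 - j" for j
    using q unfolding P_def by (subst degree_prod_eq_sum_degree) auto
  have "coeff (P j) (n - 1 - j) = lead_coeff (P j)" for j by (simp add: degP)
  also have "\<dots> j = (\<Prod>r<n - 1 - j. - (1 / q ^ r))" for j
    using q by (simp add: P_def lead_coeff_prod)
  finally have coeffP: "coeff (P j) (n - 1 - j) = (\<Prod>r<n - 1 - j. - (1 / q ^ r))" for j .
  define E where "E = mat n n (\<lambda>(i, j). poly (P j) (q ^ l i))"
  have "schur lam t = det (mat n n (\<lambda>(i, j). 1 / w (l i) * E $$ (i, j)))"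
    unfolding schur_def n_def[symmetric]
    by (rule arg_cong[of _ _ det], rule eq_matI) (auto simp: entry E_def, auto simp: jacobi_trudi_mat_def)
  also have "\<dots> = (\<Prod>i<n. 1 / w (l i)) * det E"
  proof -
    have "p i < n" if "p permutes {0..<n}" "i < n" for p i
      using permutes_in_image[OF that(1), of i] that by simp
    then show ?thesis
      by (subst (1 2) det_def'[of _ n])
         (auto simp: E_def sum_distrib_left prod_dividef atLeast0LessThan intro!: sum.cong)
  qed
  also have "det E = (\<Prod>j<n. \<Prod>r\<in>{j<..<n}. q ^ l j - q ^ l r) * (\<Prod>j<n. coeff (P j) (n - 1 - j))"
    unfolding E_def by (rule det_poly_eval) (simp add: degP)
  \<comment> \<open>The smaller of the two powers, \<open>q ^ l r\<close>, is pulled out of each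
    difference, so that the remaining factors match \<open>prod_hooks\<close>. The sign that appears
    recurs in the leading coefficients below and squares to 1.\<close>
  also have "(\<Prod>j<n. \<Prod>r\<in>{j<..<n}. q ^ l j - q ^ l r)
      = (\<Prod>j<n. \<Prod>r\<in>{j<..<n}. - 1) * (\<Prod>j<n. \<Prod>r\<in>{j<..<n}. q ^ l r) * (\<Prod>j<n. \<Prod>r\<in>{j<..<n}. 1 - q ^ (l j - l r))"
    unfolding prod.distrib[symmetric]
  proof (intro prod.cong refl)
    fix j r assume "j \<in> {..<n}" "r \<in> {j<..<n}"
    then have "l r < l j" using shifted_part_less[OF lam, of j r n] by (simp add: l_def)
    then have "q ^ l j = q ^ l r * q ^ (l j - l r)" by (simp flip: power_add)
    then show "q ^ l j - q ^ l r = - 1 * q ^ l r * (1 - q ^ (l j - l r))" by (simp add: algebra_simps)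
  qed
  also have "(\<Prod>j<n. coeff (P j) (n - 1 - j)) = (\<Prod>j<n. \<Prod>r\<in>{j<..<n}. - 1) * (1 / q ^ (\<Sum>m<n. \<Sum>r<m. r))"
  proof -
    have "(\<Prod>j<n. coeff (P j) (n - 1 - j)) = (\<Prod>j<n. (\<Prod>r\<in>{j<..<n}. - 1) * (\<Prod>r<n - 1 - j. 1 / q ^ r))"
      unfolding coeffP prod_uminus by simp
    also have "\<dots> = (\<Prod>j<n. \<Prod>r\<in>{j<..<n}. - 1) * (\<Prod>m<n. \<Prod>r<m. 1 / q ^ r)"
      unfolding prod.distrib
      by (rule arg_cong[of _ _ "\<lambda>x. _ * x"],
          rule prod.reindex_bij_witness[of _ "\<lambda>l. n - 1 - l" "\<lambda>l. n - 1 - l"]) auto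
    also have "(\<Prod>m<n. \<Prod>r<m. 1 / q ^ r) = 1 / q ^ (\<Sum>m<n. \<Sum>r<m. r)"
      by (simp add: power_sum prod_dividef)
    finally show ?thesis .
  qed
  \<comment> \<open>Row r occurs once for every j < r, giving q^(r l_r); \<open>l r\<close> splits
    into the part, which yields b(\<lambda>), and the staircase.\<close>
  also have "(\<Prod>j<n. \<Prod>r\<in>{j<..<n}. q ^ l r) = q ^ (b_stat lam + (\<Sum>m<n. \<Sum>r<m. r))"
  proof -
    have "(\<Prod>j<n. \<Prod>r\<in>{j<..<n}. q ^ l r) = (\<Prod>j<n. \<Prod>r | r < n \<and> j < r. q ^ l r)"
      by (intro prod.cong) auto
    also have "\<dots> = (\<Prod>r<n. \<Prod>j | j < n \<and> j < r. q ^ l r)"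
      using prod.swap_restrict[of "{..<n}" "{..<n}" "\<lambda>j r. q ^ l r" "\<lambda>j r. j < r"] by simp
    also have "\<dots> = (\<Prod>r<n. q ^ (r * l r))"
    proof (intro prod.cong refl)
      fix r assume "r \<in> {..<n}"
      then have "{j. j < n \<and> j < r} = {..<r}" by auto
      then show "(\<Prod>j | j < n \<and> j < r. q ^ l r) = q ^ (r * l r)"
        by (simp add: mult.commute flip: power_mult)
    qed
    also have "\<dots> = q ^ (\<Sum>r<n. r * part lam (r + 1) + r * (n - 1 - r))"
      unfolding l_def shifted_part_def distrib_left by (simp only: power_sum)
    also have "(\<Sum>r<n. r * part lam (r + 1) + r * (n - 1 - r)) = b_stat lam + (\<Sum>m<n. \<Sum>r<m. r)"
      unfolding sum.distrib sum_index_mult_complement by (simp add: b_stat_eq n_def)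
    finally show ?thesis .
  qed
  finally have s: "schur lam t = (\<Prod>i<n. 1 / w (l i)) * ((\<Prod>j<n. \<Prod>r\<in>{j<..<n}. - 1) ^ 2)
      * q ^ b_stat lam * (\<Prod>j<n. \<Prod>r\<in>{j<..<n}. 1 - q ^ (l j - l r))"
    using q by (simp add: power_add power2_eq_square)
  have "1 - q ^ (l j - l r) \<noteq> 0" if "r \<in> {j<..<n}" for j r
    using shifted_part_less[OF lam, of j r n] that by (intro ne) (simp add: l_def Suc_le_eq)
  then have D: "(\<Prod>j<n. \<Prod>r\<in>{j<..<n}. 1 - q ^ (l j - l r)) \<noteq> 0"
    by (simp only: prod_zero_iff finite_lessThan finite_greaterThanLessThan) blast
  have "1 - q ^ hook lam c \<noteq> 0" if "c \<in> diagram lam" for c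
    using hook_pos[OF lam that] by (intro ne) (simp add: Suc_le_eq)
  then have H: "(\<Prod>c\<in>diagram lam. 1 - q ^ hook lam c) \<noteq> 0"
    by (simp only: prod_zero_iff finite_diagram) blast
  have "(\<Prod>i<n. w (l i)) = (\<Prod>c\<in>diagram lam. 1 - q ^ hook lam c) * (\<Prod>j<n. \<Prod>r\<in>{j<..<n}. 1 - q ^ (l j - l r))"
    unfolding w_def l_def n_def by (rule prod_hooks[OF lam])
  moreover have "((\<Prod>j<n. \<Prod>r\<in>{j<..<n}. - 1) ^ 2 :: real) = 1"
    by (simp flip: power_sum power_mult)
  ultimately show ?thesis
    using D H unfolding s t_def[symmetric] by (simp add: prod_dividef)
qed

lemma one_minus_power_eq: "1 - p ^ n = (1 - p) * (\<Sum>i<n. p ^ i)" for p :: real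
  using one_diff_power_eq[of p n] by simp

text \<open>\<open>p \<rightarrow> 1\<close> in the principal specialization at \<open>(1 - p) p\<^sup>i\<close>, \<open>i \<ge> 0\<close>.\<close>

lemma exponential_limit:
  assumes "k \<ge> 1"
  shows "((\<lambda>p. (1 - p) ^ k * (1 / (real k * (1 - p ^ k)))) \<longlongrightarrow> (if k = 1 then 1 else 0)) (at_left (1 :: real))"
proof -
  \<comment> \<open>One factor 1 - p cancels against 1 - p^k. What is left of the power is (1 -
    p)^(k-1), and 0^0 = 1 singles out k = 1.\<close>
  have "((\<lambda>p. (1 - p) ^ (k - 1) * (1 / (real k * (\<Sum>i<k. p ^ i)))) \<longlongrightarrow>
      (1 - 1) ^ (k - 1) * (1 / (real k * (\<Sum>i<k. 1 ^ i)))) (at_left (1 :: real))"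
    using assms by (intro tendsto_intros) auto
  also have "(1 - 1) ^ (k - 1) * (1 / (real k * (\<Sum>i<k. 1 ^ i))) = (if k = 1 then 1 else 0 :: real)"
    using assms by (auto simp: power_0_left)
  finally show ?thesis
  proof (rule Lim_transform_eventually)
    have "eventually (\<lambda>p :: real. p < 1) (at_left 1)" by (simp add: eventually_at_filter)
    then show "eventually (\<lambda>p. (1 - p) ^ (k - 1) * (1 / (real k * (\<Sum>i<k. p ^ i)))
        = (1 - p) ^ k * (1 / (real k * (1 - p ^ k)))) (at_left (1 :: real))"
    proof eventually_elim
      case (elim p)
      have "(1 - p) ^ k = (1 - p) ^ (k - 1) * (1 - p)"
        using assms by (simp flip: power_Suc2)
      then show ?case using elim by (simp add: one_minus_power_eq[of p k])
    qed
  qed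
qed

text \<open>Scaling the geometric variables by 1 - p contributes |\<lambda>| factors, one per cell,
  and (1 - p) / (1 - p^h) tends to 1 / h.\<close>

lemma schur_exponential:
  assumes lam: "lam \<in> int_partitions"
  shows "schur lam (\<lambda>k. if k = 1 then 1 else 0) = (\<Prod>c\<in>diagram lam. 1 / real (hook lam c))"
proof -
  let ?t = "\<lambda>p k. (1 - p) ^ k * (1 / (real k * (1 - p ^ k)))"
  have "((\<lambda>p. schur lam (?t p)) \<longlongrightarrow> schur lam (\<lambda>k. if k = 1 then 1 else 0)) (at_left 1)"
    by (intro tendsto_schur exponential_limit)
  moreover have "((\<lambda>p. schur lam (?t p)) \<longlongrightarrow> (\<Prod>c\<in>diagram lam. 1 / real (hook lam c))) (at_left 1)"
  proof (rule Lim_transform_eventually)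
    have "((\<lambda>p. p ^ b_stat lam * (\<Prod>c\<in>diagram lam. 1 / (\<Sum>i<hook lam c. p ^ i))) \<longlongrightarrow>
        1 ^ b_stat lam * (\<Prod>c\<in>diagram lam. 1 / (\<Sum>i<hook lam c. 1 ^ i))) (at_left (1 :: real))"
      using hook_pos[OF lam] by (intro tendsto_intros) auto
    then show "((\<lambda>p. p ^ b_stat lam * (\<Prod>c\<in>diagram lam. 1 / (\<Sum>i<hook lam c. p ^ i))) \<longlongrightarrow>
        (\<Prod>c\<in>diagram lam. 1 / real (hook lam c))) (at_left 1)" by simp
    have "eventually (\<lambda>p :: real. p \<in> {0<..<1}) (at_left 1)"
      by (rule eventually_at_left_real) simp
    then show "eventually (\<lambda>p. p ^ b_stat lam * (\<Prod>c\<in>diagram lam. 1 / (\<Sum>i<hook lam c. p ^ i))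
        = schur lam (?t p)) (at_left (1 :: real))"
    proof eventually_elim
      case (elim p)
      have "(1 - p) ^ sum_list lam * (\<Prod>c\<in>diagram lam. 1 / (1 - p ^ hook lam c))
          = (\<Prod>c\<in>diagram lam. (1 - p) * (1 / (1 - p ^ hook lam c)))"
        by (simp only: prod.distrib) (simp add: card_diagram)
      also have "\<dots> = (\<Prod>c\<in>diagram lam. 1 / (\<Sum>i<hook lam c. p ^ i))"
        using elim by (simp add: one_minus_power_eq)
      finally show ?case using elim
        by (simp only: schur_scale) (simp add: schur_geometric[OF _ _ lam])
    qed
  qed
  ultimately show ?thesis by (rule tendsto_unique[rotated]) simp
qed

section \<open>The Cauchy--Binet formula\<close>

text \<open>Each set of n columns below K is represented by its decreasing enumeration, matching the
  order of the shifted parts. Extensionality outside \<open>{0..<n}\<close> makes the representative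
  unique.\<close>

definition strict_dec :: "nat \<Rightarrow> nat \<Rightarrow> (nat \<Rightarrow> nat) set" where
  "strict_dec n K = {f \<in> {0..<n} \<rightarrow>\<^sub>E {..<K}. \<forall>i j. i < j \<longrightarrow> j < n \<longrightarrow> f j < f i}"

lemma strict_dec_inj_on:
  assumes "f \<in> strict_dec n K"
  shows "inj_on f {0..<n}"
proof (rule linorder_inj_onI')
  fix i j assume "i \<in> {0..<n}" "j \<in> {0..<n}" "i < j"
  then have "f j < f i" using assms by (simp add: strict_dec_def)
  then show "f i \<noteq> f j" by simp
qed

lemma finite_strict_dec [simp]: "finite (strict_dec n K)"
  unfolding strict_dec_def by (rule finite_subset[of _ "{0..<n} \<rightarrow>\<^sub>E {..<K}"]) (auto intro: finite_PiE)

lemma strict_dec_image_inject: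
  assumes f: "f \<in> strict_dec n K" and g: "g \<in> strict_dec n K"
    and eq: "f ` {0..<n} = g ` {0..<n}"
  shows "f = g"
proof -
  have "sorted_wrt (<) (map h (rev [0..<n]))" if "h \<in> strict_dec n K" for h
    using that by (auto simp: sorted_wrt_iff_nth_less rev_nth strict_dec_def)
  moreover have "set (map f (rev [0..<n])) = set (map g (rev [0..<n]))"
    using eq by simp
  ultimately have "map f (rev [0..<n]) = map g (rev [0..<n])"
    using f g by (intro strict_sorted_equal) auto
  then have "f i = g i" if "i \<in> {0..<n}" for i
    using that by simp
  then show ?thesis
    using f g by (intro extensionalityI[of f "{0..<n}" g]) (auto simp: strict_dec_def PiE_def)
qed

text \<open>An injection factors uniquely as the decreasing enumeration of its image composed with a
  permutation of the arguments.\<close>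

lemma bij_betw_strict_dec_permutes:
  "bij_betw (\<lambda>(g, p). restrict (g \<circ> p) {0..<n}) (strict_dec n K \<times> {p. p permutes {0..<n}})
     {f \<in> {0..<n} \<rightarrow>\<^sub>E {..<K}. inj_on f {0..<n}}"
  (is "bij_betw ?F (?S \<times> ?P) ?I")
proof (rule bij_betw_imageI)
  have im: "restrict (g \<circ> p) {0..<n} ` {0..<n} = g ` {0..<n}" if "p \<in> ?P" for g p
    using permutes_image[of p "{0..<n}"] image_comp[of g p "{0..<n}"] that by simp
  show "inj_on ?F (?S \<times> ?P)"
  proof (rule inj_onI, clarify)
    fix g p g' p'
    assume g: "g \<in> ?S" "g' \<in> ?S" and p: "p permutes {0..<n}" "p' permutes {0..<n}"
      and eq: "restrict (g \<circ> p) {0..<n} = restrict (g' \<circ> p') {0..<n}"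
    have "g ` {0..<n} = g' ` {0..<n}" using im[of p g] im[of p' g'] p eq by simp
    then have gg: "g = g'" using g strict_dec_image_inject by blast
    moreover have "p i = p' i" for i
    proof (cases "i \<in> {0..<n}")
      case True
      then have "g (p i) = g (p' i)"
        using fun_cong[OF eq, of i] gg by simp
      then show ?thesis
        using inj_onD[OF strict_dec_inj_on[OF g(1)]] permutes_in_image[OF p(1)] permutes_in_image[OF p(2)] True
        by blast
    next
      case False
      then show ?thesis using p by (simp add: permutes_not_in)
    qed
    ultimately show "g = g' \<and> p = p'" by auto
  qed
  show "?F ` (?S \<times> ?P) = ?I"
  proof (intro subset_antisym subsetI)
    fix f assume "f \<in> ?F ` (?S \<times> ?P)"
    then obtain g p where g: "g \<in> ?S" and p: "p permutes {0..<n}" and f: "f = restrict (g \<circ> p) {0..<n}"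
      by auto
    have "inj_on (g \<circ> p) {0..<n}"
      using strict_dec_inj_on[OF g] p by (simp add: comp_inj_on permutes_image permutes_inj_on)
    moreover have "g (p i) < K" if "i < n" for i
      using g permutes_in_image[OF p, of i] that by (auto simp: strict_dec_def PiE_iff)
    ultimately show "f \<in> ?I" by (auto simp: f inj_on_restrict_eq)
  next
    fix f assume f: "f \<in> ?I"
    let ?M = "f ` {0..<n}"
    have cM: "card ?M = n" using f by (simp add: card_image)
    have "finite ?M" by simp
    from ex_bij_betw_strict_mono_card[OF this] obtain h
      where h: "bij_betw h {0..<n} ?M" "strict_mono_on {0..<n} h"
      unfolding cM lessThan_atLeast0 by blast
    \<comment> \<open>\<open>h\<close> enumerates the image increasingly, hence the reversal;
      \<open>p\<close> below records the position of \<open>f i\<close> in the reversed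
      enumeration.\<close>
    define g where "g = restrict (\<lambda>j. h (n - 1 - j)) {0..<n}"
    have hM: "h j \<in> ?M" if "j < n" for j using h(1) that by (auto simp: bij_betw_def)
    have g: "g \<in> ?S"
      unfolding strict_dec_def
    proof (intro CollectI conjI allI impI)
      show "g \<in> {0..<n} \<rightarrow>\<^sub>E {..<K}"
      proof (rule PiE_I)
        fix i assume i: "i \<in> {0..<n}"
        then have "h (n - 1 - i) \<in> ?M" by (intro hM) auto
        also have "?M \<subseteq> {..<K}" using f by auto
        finally show "g i \<in> {..<K}" using i by (simp add: g_def)
      qed (auto simp: g_def)
      fix i j assume "i < j" "j < n"
      then show "g j < g i"
        by (auto simp: g_def intro!: strict_mono_onD[OF h(2)])
    qed
    have gim: "g ` {0..<n} = ?M"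
    proof -
      have "g ` {0..<n} = h ` ((\<lambda>j. n - 1 - j) ` {0..<n})"
        by (auto simp: g_def image_image intro!: image_cong)
      also have "(\<lambda>j. n - 1 - j) ` {0..<n} = {0..<n}"
        by (rule endo_inj_surj) (auto simp: inj_on_def)
      finally show ?thesis using h(1) by (simp add: bij_betw_def)
    qed
    define p where "p = (\<lambda>i. if i \<in> {0..<n} then inv_into {0..<n} g (f i) else i)"
    have gp: "g (p i) = f i" and pn: "p i \<in> {0..<n}" if "i \<in> {0..<n}" for i
    proof -
      have "f i \<in> g ` {0..<n}" using that gim by blast
      then show "g (p i) = f i" "p i \<in> {0..<n}"
        using that by (simp_all only: p_def if_True f_inv_into_f inv_into_into)
    qed
    have "inj_on p {0..<n}"
    proof (rule inj_onI)
      fix i j assume "i \<in> {0..<n}" "j \<in> {0..<n}" "p i = p j"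
      then show "i = j" using gp[of i] gp[of j] f by (auto dest: inj_onD)
    qed
    then have "p ` {0..<n} = {0..<n}" using pn by (intro endo_inj_surj) auto
    then have "p permutes {0..<n}"
      using \<open>inj_on p {0..<n}\<close> by (intro bij_imp_permutes) (auto simp: bij_betw_def p_def)
    moreover have "f = restrict (g \<circ> p) {0..<n}"
      using f gp by (intro extensionalityI[of f "{0..<n}"]) (auto simp: PiE_def)
    ultimately show "f \<in> ?F ` (?S \<times> ?P)" using g by (intro image_eqI[of _ _ "(g, p)"]) auto
  qed
qed

text \<open>Multilinear expansion picks an index f(i) for each row i. Non-injective choices vanish;
  the injective ones are regrouped by \<open>bij_betw_strict_dec_permutes\<close>, and the sum over
  p rebuilds the determinant of the a-side.\<close>

theorem cauchy_binet:
  fixes a b :: "nat \<Rightarrow> nat \<Rightarrow> 'a :: comm_ring_1"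
  shows "det (mat n n (\<lambda>(i, j). \<Sum>k<K. a i k * b j k))
    = (\<Sum>g\<in>strict_dec n K. det (mat n n (\<lambda>(i, j). a i (g j))) * det (mat n n (\<lambda>(i, j). b i (g j))))"
proof -
  \<comment> \<open>Transposed, so that f selects rows: repeated values become equal rows, and
    permuting the arguments of f becomes a row permutation.\<close>
  define B where "B = (\<lambda>f. mat n n (\<lambda>(i, j). b j (f i)))"
  let ?A = "\<lambda>f. \<Prod>i = 0..<n. a i (f i)"
  let ?E = "{0..<n} \<rightarrow>\<^sub>E {..<K}" and ?P = "{p. p permutes {0..<n}}"
  have BC: "B f \<in> carrier_mat n n" for f by (simp add: B_def)
  have pn: "p i < n" if "p permutes {0..<n}" "i < n" for p i
    using permutes_in_image[OF that(1), of i] that by simp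
  have "det (mat n n (\<lambda>(i, j). \<Sum>k<K. a i k * b j k))
      = (\<Sum>p\<in>?P. signof p * (\<Prod>i = 0..<n. \<Sum>k<K. a i k * b (p i) k))"
    by (subst det_def'[of _ n]) (auto intro!: sum.cong prod.cong simp: pn)
  also have "\<dots> = (\<Sum>p\<in>?P. signof p * (\<Sum>f\<in>?E. \<Prod>i = 0..<n. a i (f i) * b (p i) (f i)))"
    by (subst prod_sum_PiE) auto
  also have "\<dots> = (\<Sum>p\<in>?P. \<Sum>f\<in>?E. ?A f * (signof p * (\<Prod>i = 0..<n. b (p i) (f i))))"
    by (simp add: sum_distrib_left prod.distrib ac_simps)
  also have "\<dots> = (\<Sum>f\<in>?E. \<Sum>p\<in>?P. ?A f * (signof p * (\<Prod>i = 0..<n. b (p i) (f i))))"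
    by (rule sum.swap)
  also have "\<dots> = (\<Sum>f\<in>?E. ?A f * det (B f))"
    unfolding det_def'[OF BC] sum_distrib_left
    by (intro sum.cong prod.cong refl arg_cong2[of _ _ _ _ "(*)"]) (auto simp: B_def pn)
  also have "\<dots> = (\<Sum>f\<in>{f \<in> ?E. inj_on f {0..<n}}. ?A f * det (B f))"
  proof (rule sum.mono_neutral_right)
    show "\<forall>f\<in>?E - {f \<in> ?E. inj_on f {0..<n}}. ?A f * det (B f) = 0"
    proof
      fix f assume "f \<in> ?E - {f \<in> ?E. inj_on f {0..<n}}"
      then obtain i j where ij: "i < n" "j < n" "i \<noteq> j" "f i = f j" by (auto simp: inj_on_def)
      then have "row (B f) i = row (B f) j" by (auto simp: B_def)
      then have "det (B f) = 0" using ij by (intro det_identical_rows[OF BC ij(3) ij(1) ij(2)]) auto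
      then show "?A f * det (B f) = 0" by simp
    qed
  qed (auto intro: finite_PiE)
  also have "\<dots> = (\<Sum>(g, p)\<in>strict_dec n K \<times> ?P. ?A (restrict (g \<circ> p) {0..<n}) * det (B (restrict (g \<circ> p) {0..<n})))"
    using sum.reindex_bij_betw[OF bij_betw_strict_dec_permutes, of "\<lambda>f. ?A f * det (B f)" n K]
    by (simp add: case_prod_beta)
  also have "\<dots> = (\<Sum>g\<in>strict_dec n K. \<Sum>p\<in>?P. ?A (restrict (g \<circ> p) {0..<n}) * det (B (restrict (g \<circ> p) {0..<n})))"
    by (rule sum.cartesian_product[symmetric])
  also have "\<dots> = (\<Sum>g\<in>strict_dec n K. (\<Sum>p\<in>?P. signof p * (\<Prod>i = 0..<n. a i (g (p i)))) * det (B g))"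
    unfolding sum_distrib_right
  proof (intro sum.cong refl)
    fix g p assume p: "p \<in> ?P"
    have "B (restrict (g \<circ> p) {0..<n}) = mat n n (\<lambda>(i, j). B g $$ (p i, j))"
      using p by (intro eq_matI) (auto simp: B_def pn)
    then have "det (B (restrict (g \<circ> p) {0..<n})) = signof p * det (B g)"
      using det_permute_rows[OF BC] p by simp
    then show "?A (restrict (g \<circ> p) {0..<n}) * det (B (restrict (g \<circ> p) {0..<n}))
        = signof p * (\<Prod>i = 0..<n. a i (g (p i))) * det (B g)"
      by (simp add: ac_simps)
  qed
  also have "\<dots> = (\<Sum>g\<in>strict_dec n K. det (mat n n (\<lambda>(i, j). a i (g j))) * det (mat n n (\<lambda>(i, j). b i (g j))))"
  proof (intro sum.cong refl arg_cong2[of _ _ _ _ "(*)"])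
    fix g
    show "(\<Sum>p\<in>?P. signof p * (\<Prod>i = 0..<n. a i (g (p i)))) = det (mat n n (\<lambda>(i, j). a i (g j)))"
      by (subst det_def'[of _ n]) (auto intro!: sum.cong prod.cong simp: pn)
    have "B g = transpose_mat (mat n n (\<lambda>(i, j). b i (g j)))"
      by (rule eq_matI) (auto simp: B_def)
    then show "det (B g) = det (mat n n (\<lambda>(i, j). b i (g j)))"
      by (simp add: det_transpose[of _ n])
  qed
  finally show ?thesis .
qed


section \<open>The Cauchy determinant\<close>

text \<open>After clearing denominators row \<open>i\<close> consists of values at \<open>x\<^sub>i\<close> of the polynomials
  \<open>\<Prod>\<^sub>l\<^sub>\<noteq>\<^sub>j (1 - y\<^sub>l T)\<close>, whose coefficients are monic polynomials in \<open>y\<^sub>j\<close>.\<close>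

lemma cauchy_determinant:
  fixes x y :: "nat \<Rightarrow> 'a :: idom"
  assumes C: "\<And>i j. i < n \<Longrightarrow> j < n \<Longrightarrow> C i j * (1 - x i * y j) = 1"
  shows "det (mat n n (\<lambda>(i, j). C i j)) * (\<Prod>i<n. \<Prod>j<n. 1 - x i * y j)
    = (\<Prod>j<n. \<Prod>r\<in>{j<..<n}. x j - x r) * (\<Prod>j<n. \<Prod>r\<in>{j<..<n}. y j - y r)"
proof -
  define F where "F = (\<Prod>l<n. [:1, - y l:])"
  define G where "G = (\<lambda>j. \<Prod>l\<in>{..<n} - {j}. [:1, - y l:])"
  define Q where "Q = (\<lambda>k. \<Sum>r\<le>n - 1 - k. monom (coeff F (n - 1 - k - r)) r)"
  define d where "d = (\<lambda>i. \<Prod>j<n. 1 - x i * y j)"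
  define A where "A = mat n n (\<lambda>(i, k). x i ^ (n - 1 - k))"
  define B where "B = mat n n (\<lambda>(k, j). coeff (G j) (n - 1 - k))"
  have FG: "F = [:1, - y j:] * G j" if "j < n" for j
    unfolding F_def G_def using that by (intro prod.remove) auto
  \<comment> \<open>Since G_j = F / (1 - y_j T), its coefficients are those of F times a geometric
    series in y_j T. F does not depend on j, so the coefficient of degree n - 1 - k is
    \<open>Q k\<close> at y_j; \<open>Q k\<close> is monic because F has constant term 1.\<close>
  have coeffG: "coeff (G j) m = (\<Sum>r\<le>m. y j ^ r * coeff F (m - r))" if "j < n" for j m
  proof (induction m)
    case 0
    show ?case using FG[OF that] by simp
  next
    case (Suc m)
    have "coeff F (Suc m) = coeff (G j) (Suc m) - y j * coeff (G j) m"
      by (simp add: FG[OF that])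
    then have "coeff (G j) (Suc m) = coeff F (Suc m) + y j * (\<Sum>r\<le>m. y j ^ r * coeff F (m - r))"
      using Suc by simp
    then show ?case by (simp add: sum.atMost_Suc_shift sum_distrib_left mult.assoc del: sum.atMost_Suc)
  qed
  have coeffF0: "coeff F 0 = 1"
    by (simp add: F_def poly_0_coeff_0[symmetric] poly_prod)
  have degQ: "degree (Q k) \<le> n - 1 - k" for k
    unfolding Q_def by (rule degree_sum_le) (auto intro: order.trans[OF degree_monom_le])
  have coeffQ: "coeff (Q k) (n - 1 - k) = 1" for k
    using coeffF0 by (simp add: Q_def coeff_sum)
  have "degree (G j) \<le> n - 1" if "j < n" for j
  proof -
    have "degree (G j) \<le> (\<Sum>l\<in>{..<n} - {j}. degree [:1, - y l:])"
      unfolding G_def using degree_prod_sum_le[of "{..<n} - {j}" "\<lambda>l. [:1, - y l:]"] by (simp add: o_def)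
    also have "\<dots> \<le> (\<Sum>l\<in>{..<n} - {j}. 1)" by (intro sum_mono) auto
    finally show ?thesis using that by simp
  qed
  note degG = this
  have "mat n n (\<lambda>(i, j). d i * C i j) = A * B"
  proof (rule eq_matI)
    fix i j assume "i < dim_row (A * B)" "j < dim_col (A * B)"
    then have i: "i < n" and j: "j < n" by (auto simp: A_def B_def)
    have "d i = (1 - x i * y j) * (\<Prod>l\<in>{..<n} - {j}. 1 - x i * y l)"
      unfolding d_def using j by (intro prod.remove) auto
    then have "d i * C i j = (C i j * (1 - x i * y j)) * (\<Prod>l\<in>{..<n} - {j}. 1 - x i * y l)"
      by (simp only: ac_simps)
    also have "\<dots> = poly (G j) (x i)"
      unfolding C[OF i j] by (simp add: G_def poly_prod)
    also have "\<dots> = (\<Sum>r\<le>degree (G j). coeff (G j) r * x i ^ r)"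
      by (rule poly_altdef)
    also have "\<dots> = (\<Sum>r<n. coeff (G j) r * x i ^ r)"
      using degG[OF j] j by (intro sum.mono_neutral_left) (auto simp: coeff_eq_0)
    also have "\<dots> = (\<Sum>k<n. x i ^ (n - 1 - k) * coeff (G j) (n - 1 - k))"
      by (rule sum.reindex_bij_witness[of _ "\<lambda>l. n - 1 - l" "\<lambda>l. n - 1 - l"]) auto
    finally show "mat n n (\<lambda>(i, j). d i * C i j) $$ (i, j) = (A * B) $$ (i, j)"
      using i j by (simp add: A_def B_def scalar_prod_def atLeast0LessThan)
  qed (auto simp: A_def B_def)
  then have "det (mat n n (\<lambda>(i, j). d i * C i j)) = det A * det B"
    using det_mult[of A n B] by (simp add: A_def B_def)
  moreover have "det A = (\<Prod>j<n. \<Prod>r\<in>{j<..<n}. x j - x r)"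
    unfolding A_def by (rule det_vandermonde)
  moreover have "det B = (\<Prod>j<n. \<Prod>r\<in>{j<..<n}. y j - y r)"
  proof -
    have "B = transpose_mat (mat n n (\<lambda>(j, k). poly (Q k) (y j)))"
      by (rule eq_matI) (auto simp: B_def Q_def coeffG poly_sum poly_monom mult.commute)
    then have "det B = det (mat n n (\<lambda>(j, k). poly (Q k) (y j)))"
      by (simp add: det_transpose[of _ n])
    also have "\<dots> = (\<Prod>j<n. \<Prod>r\<in>{j<..<n}. y j - y r)"
      using det_poly_eval[of n Q y] degQ by (simp only: coeffQ) simp
    finally show ?thesis .
  qed
  moreover have "det (mat n n (\<lambda>(i, j). d i * C i j)) = (\<Prod>i<n. d i) * det (mat n n (\<lambda>(i, j). C i j))"
  proof -
    have "p i < n" if "p permutes {0..<n}" "i < n" for p i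
      using permutes_in_image[OF that(1), of i] that by simp
    then show ?thesis
      by (subst (1 2) det_def'[of _ n])
         (auto simp: sum_distrib_left prod.distrib atLeast0LessThan intro!: sum.cong)
  qed
  ultimately show ?thesis by (simp add: d_def mult.commute)
qed

section \<open>The Cauchy identity in finitely many variables, degree by degree\<close>

lemma det_fps_const_X_power:
  fixes A :: "nat \<Rightarrow> nat \<Rightarrow> 'a :: comm_ring_1"
  shows "det (mat n n (\<lambda>(i, j). fps_const (A i j) * fps_X ^ g j))
    = fps_const (det (mat n n (\<lambda>(i, j). A i j))) * fps_X ^ (\<Sum>j<n. g j)"
proof -
  interpret c: comm_ring_hom "fps_const :: 'a \<Rightarrow> 'a fps"
    by unfold_locales auto
  have pn: "p i < n" if "p permutes {0..<n}" "i < n" for p i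
    using permutes_in_image[OF that(1), of i] that by simp
  have "(\<Prod>i = 0..<n. fps_const (A i (p i)) * fps_X ^ g (p i))
      = fps_const (\<Prod>i = 0..<n. A i (p i)) * fps_X ^ (\<Sum>j<n. g j)" if "p permutes {0..<n}" for p
    using sum.permute[OF that, of g]
    by (simp add: prod.distrib c.hom_prod power_sum atLeast0LessThan o_def)
  then show ?thesis
    by (subst (1 2) det_def'[of _ n])
       (auto simp: c.hom_sum c.hom_mult sum_distrib_right pn mult.assoc intro!: sum.cong)
qed

lemma fps_nth_prod_cong:
  fixes f g :: "'b \<Rightarrow> 'a :: comm_ring_1 fps"
  assumes "\<And>i r. i \<in> S \<Longrightarrow> r \<le> m \<Longrightarrow> fps_nth (f i) r = fps_nth (g i) r" and "r \<le> m"
  shows "fps_nth (prod f S) r = fps_nth (prod g S) r"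
  using assms
proof (induction S arbitrary: r rule: infinite_finite_induct)
  case (insert i S)
  then show ?case by (auto simp: fps_mult_nth intro!: sum.cong arg_cong2[of _ _ _ _ "(*)"])
qed auto

text \<open>A coefficient of degree m only sees the entries modulo X^(m+1). This allows infinite
  geometric series to be cut to the finite sums that \<open>cauchy_binet\<close> requires.\<close>

lemma fps_nth_det_cong:
  fixes A B :: "'a :: comm_ring_1 fps mat"
  assumes A: "A \<in> carrier_mat n n" and B: "B \<in> carrier_mat n n"
    and eq: "\<And>i j r. i < n \<Longrightarrow> j < n \<Longrightarrow> r \<le> m \<Longrightarrow> fps_nth (A $$ (i, j)) r = fps_nth (B $$ (i, j)) r"
  shows "fps_nth (det A) m = fps_nth (det B) m"
proof -
  have pn: "p i < n" if "p permutes {0..<n}" "i < n" for p i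
    using permutes_in_image[OF that(1), of i] that by simp
  have "fps_nth (\<Prod>i = 0..<n. A $$ (i, p i)) m = fps_nth (\<Prod>i = 0..<n. B $$ (i, p i)) m"
    if "p permutes {0..<n}" for p
    by (rule fps_nth_prod_cong[of _ m]) (auto simp: eq pn that)
  then show ?thesis
    unfolding det_def'[OF A] det_def'[OF B] fps_sum_nth
    by (intro sum.cong) (auto simp: sign_def)
qed

text \<open>Modulo X^(m+1) the entries are finite sums over k \<le> m, with the x-side carrying X^k.
  In the Cauchy-Binet expansion a choice g contributes X to the power of its sum, and the
  coefficient keeps those of sum m.\<close>

lemma fps_nth_det_geometric:
  fixes x y :: "nat \<Rightarrow> 'a :: comm_ring_1"
  shows "fps_nth (det (mat n n (\<lambda>(i, j). Abs_fps (\<lambda>k. (x i * y j) ^ k)))) m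
    = (\<Sum>g | g \<in> strict_dec n (Suc m) \<and> (\<Sum>j<n. g j) = m.
         det (mat n n (\<lambda>(i, j). x i ^ g j)) * det (mat n n (\<lambda>(i, j). y i ^ g j)))"
proof -
  let ?a = "\<lambda>i k. fps_const (x i ^ k) * fps_X ^ k" and ?b = "\<lambda>j k. fps_const (y j ^ k)"
  let ?D = "\<lambda>z g. det (mat n n (\<lambda>(i, j). z i ^ g j))"
  let ?S = "strict_dec n (Suc m)"
  have "fps_nth (\<Sum>k<Suc m. ?a i k * ?b j k) r = (x i * y j) ^ r" if "r \<le> m" for i j r
  proof -
    have "fps_nth (\<Sum>k<Suc m. ?a i k * ?b j k) r = (\<Sum>k<Suc m. if k = r then (x i * y j) ^ k else 0)"
      unfolding fps_sum_nth by (intro sum.cong) (auto simp: power_mult_distrib fps_X_power_iff)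
    then show ?thesis using that by simp
  qed
  then have "fps_nth (det (mat n n (\<lambda>(i, j). Abs_fps (\<lambda>k. (x i * y j) ^ k)))) m
      = fps_nth (det (mat n n (\<lambda>(i, j). \<Sum>k<Suc m. ?a i k * ?b j k))) m"
    by (intro fps_nth_det_cong[of _ n]) (auto simp del: sum.lessThan_Suc)
  also have "\<dots> = (\<Sum>g\<in>?S. fps_nth (fps_const (?D x g) * fps_X ^ (\<Sum>j<n. g j) * fps_const (?D y g)) m)"
  proof -
    have "det (mat n n (\<lambda>(i, j). ?b i (g j))) = fps_const (?D y g)" for g
      using det_fps_const_X_power[of n "\<lambda>i j. y i ^ g j" "\<lambda>_. 0"] by simp
    then show ?thesis unfolding cauchy_binet fps_sum_nth det_fps_const_X_power by (simp only:)
  qed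
  also have "\<dots> = (\<Sum>g\<in>?S. if (\<Sum>j<n. g j) = m then ?D x g * ?D y g else 0)"
    by (intro sum.cong) (auto simp: fps_X_power_iff)
  also have "\<dots> = (\<Sum>g | g \<in> ?S \<and> (\<Sum>j<n. g j) = m. ?D x g * ?D y g)"
    by (simp add: sum.inter_filter)
  finally show ?thesis .
qed

section \<open>Partitions as strictly decreasing exponent sequences\<close>

lemma part_eq_0_iff:
  assumes "lam \<in> int_partitions" "1 \<le> i"
  shows "part lam i = 0 \<longleftrightarrow> length lam < i"
  using part_pos[OF assms] assms(2) by (auto simp: part_def not_le split: if_splits)

lemma part_inject:
  assumes "lam \<in> int_partitions" "mu \<in> int_partitions" "\<And>i. 1 \<le> i \<Longrightarrow> part lam i = part mu i"
  shows "lam = mu"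
proof (rule nth_equalityI)
  have "length lam < i \<longleftrightarrow> length mu < i" if "1 \<le> i" for i
    using part_eq_0_iff[OF assms(1) that] part_eq_0_iff[OF assms(2) that] assms(3)[OF that] by simp
  from this[of "Suc (length lam)"] this[of "Suc (length mu)"] show len: "length lam = length mu" by auto
  fix i assume "i < length lam"
  then show "lam ! i = mu ! i" using assms(3)[of "Suc i"] len by (simp add: part_def)
qed

lemma length_le_sum_list:
  assumes "lam \<in> int_partitions"
  shows "length lam \<le> sum_list lam"
proof -
  have "(\<Sum>i<length lam. 1) \<le> (\<Sum>i<length lam. part lam (i + 1))"
    using part_pos[OF assms] by (intro sum_mono) (simp add: Suc_le_eq)
  then show ?thesis by (simp add: sum_list_eq_sum_part)
qed

text \<open>The zeros of a weakly decreasing sequence form a tail, so cutting at the first zero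
  keeps every positive part.\<close>

lemma ex_partition_with_parts:
  assumes anti: "\<And>i j. i \<le> j \<Longrightarrow> j < n \<Longrightarrow> g j \<le> (g i :: nat)"
  obtains lam where "lam \<in> int_partitions" "length lam \<le> n" "\<And>i. i < n \<Longrightarrow> part lam (i + 1) = g i"
proof
  define xs where "xs = map g [0..<n]"
  define lam where "lam = takeWhile (\<lambda>x. 0 < x) xs"
  have len: "length lam \<le> n"
    using length_takeWhile_le[of "\<lambda>x. 0 < x" xs] by (simp add: lam_def xs_def)
  have nth: "lam ! i = g i" if "i < length lam" for i
    using takeWhile_nth[of i "\<lambda>x. 0 < x" xs] that len by (simp add: lam_def xs_def)
  show "length lam \<le> n" by (fact len)
  show "lam \<in> int_partitions"
    unfolding int_partitions_def using len
    by (auto simp: sorted_wrt_iff_nth_less nth intro!: anti) (auto simp: lam_def dest: set_takeWhileD)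
  show "part lam (i + 1) = g i" if "i < n" for i
  proof (cases "i < length lam")
    case False
    then have "g (length lam) = 0"
      using nth_length_takeWhile[of "\<lambda>x. 0 < x" xs] that by (simp add: lam_def xs_def)
    then show ?thesis using anti[of "length lam" i] False that by (simp add: part_def)
  qed (simp add: part_def nth)
qed

text \<open>Adding the staircase is inverted by subtracting it, as strict decrease forces
  \<open>g i \<ge> n - 1 - i\<close>. By \<open>N \<le> n\<close> every partition of N has at most n
  parts, and entries are below \<open>Suc m\<close> because they sum to m.\<close>

lemma bij_betw_shifted_part:
  assumes "N \<le> n"
  defines "m \<equiv> N + (\<Sum>j<n. n - 1 - j)"
  shows "bij_betw (\<lambda>lam. restrict (shifted_part n lam) {0..<n})
    {lam \<in> int_partitions. sum_list lam = N} {g \<in> strict_dec n (Suc m). (\<Sum>j<n. g j) = m}"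
  (is "bij_betw ?F ?P ?S")
proof (rule bij_betw_imageI)
  have len: "length lam \<le> n" if "lam \<in> ?P" for lam
    using length_le_sum_list[of lam] that assms by simp
  have sum_part: "(\<Sum>i<n. part lam (i + 1)) = sum_list lam" if "length lam \<le> n" for lam
    unfolding sum_list_eq_sum_part using that
    by (intro sum.mono_neutral_right) (auto simp: part_def)
  have sum_shifted: "(\<Sum>j<n. shifted_part n lam j) = (\<Sum>i<n. part lam (i + 1)) + (\<Sum>j<n. n - 1 - j)" for lam
    by (simp only: shifted_part_def sum.distrib)
  show "inj_on ?F ?P"
  proof (rule inj_onI)
    fix lam mu assume lam: "lam \<in> ?P" and mu: "mu \<in> ?P" and eq: "?F lam = ?F mu"
    show "lam = mu"
    proof (rule part_inject)
      fix i :: nat assume i: "1 \<le> i"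
      show "part lam i = part mu i"
      proof (cases "i - 1 < n")
        case True
        then show ?thesis using fun_cong[OF eq, of "i - 1"] i by (simp add: shifted_part_def)
      next
        case False
        then have "length lam < i" "length mu < i" using len[OF lam] len[OF mu] i by auto
        then show ?thesis by (simp add: part_def)
      qed
    qed (use lam mu in auto)
  qed
  show "?F ` ?P = ?S"
  proof (intro subset_antisym subsetI)
    fix g assume "g \<in> ?F ` ?P"
    then obtain lam where lam: "lam \<in> ?P" and g: "g = ?F lam" by blast
    have "(\<Sum>j<n. g j) = (\<Sum>j<n. shifted_part n lam j)" by (simp add: g)
    then have s: "(\<Sum>j<n. g j) = m"
      using sum_part[OF len[OF lam]] lam by (simp only: sum_shifted m_def mem_Collect_eq)
    have "g j < Suc m" if "j < n" for j
      using member_le_sum[of j "{..<n}" g] that s by simp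
    then have "g \<in> strict_dec n (Suc m)"
      using lam shifted_part_less[of lam _ _ n] by (auto simp: strict_dec_def g)
    then show "g \<in> ?S" using s by simp
  next
    fix g assume "g \<in> ?S"
    then have g: "g \<in> strict_dec n (Suc m)" and s: "(\<Sum>j<n. g j) = m" by auto
    have gap: "g (i + d) + d \<le> g i" if "i + d < n" for i d
      using that
    proof (induction d)
      case (Suc d)
      have "g (i + Suc d) < g (i + d)" using g Suc.prems by (simp add: strict_dec_def)
      then show ?case using Suc by simp
    qed simp
    have ge: "n - 1 - i \<le> g i" if "i < n" for i
      using gap[of i "n - 1 - i"] that by simp
    obtain lam where lam: "lam \<in> int_partitions" "length lam \<le> n"
      and part: "\<And>i. i < n \<Longrightarrow> part lam (i + 1) = g i - (n - 1 - i)"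
    proof (rule ex_partition_with_parts[of n "\<lambda>i. g i - (n - 1 - i)"])
      fix i j assume "i \<le> j" "j < n"
      then show "g j - (n - 1 - j) \<le> g i - (n - 1 - i)"
        using gap[of i "j - i"] ge[of i] ge[of j] by simp
    qed blast
    have "g i = shifted_part n lam i" if "i < n" for i
      using part[OF that] ge[OF that] by (simp add: shifted_part_def)
    then have eq: "g = ?F lam"
      using g by (intro extensionalityI[of g "{0..<n}"]) (auto simp: strict_dec_def PiE_def)
    have "m = (\<Sum>j<n. shifted_part n lam j)" using s by (simp add: eq)
    then have "sum_list lam = N"
      using sum_part[OF lam(2)] by (simp only: sum_shifted m_def add_right_cancel)
    then show "g \<in> ?F ` ?P" using lam eq by blast
  qed
qed

lemma finite_partitions_of: "finite {lam \<in> int_partitions. sum_list lam = N}"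
  using bij_betw_finite[OF bij_betw_shifted_part[of N N]] by simp

text \<open>The coefficient of X^(N+M) in the determinant of the 1 / (1 - x_i y_j X) is computed
  twice: through the Cauchy determinant, and as a sum of products of alternants, each a Schur
  function times a Vandermonde product. Distinct variables make the Vandermonde products
  cancellable.\<close>

theorem finite_cauchy_identity:
  fixes x y :: "nat \<Rightarrow> real"
  assumes inj: "inj_on x {..<n}" "inj_on y {..<n}" and N: "N \<le> n"
  shows "(\<Sum>lam | lam \<in> int_partitions \<and> sum_list lam = N.
      schur lam (\<lambda>k. (\<Sum>i<n. x i ^ k) / real k) * schur lam (\<lambda>k. (\<Sum>i<n. y i ^ k) / real k))
    = complete_hom (\<lambda>k. (\<Sum>i<n. x i ^ k) * (\<Sum>j<n. y j ^ k) / real k) N"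
proof -
  define M where "M = (\<Sum>j<n. n - 1 - j)"
  define W where "W = (\<lambda>u :: nat \<Rightarrow> real. \<Prod>j<n. \<Prod>r\<in>{j<..<n}. u j - u r)"
  define C where "C = (\<lambda>i j. Abs_fps (\<lambda>k. (x i * y j) ^ k))"
  define H where "H = complete_hom (\<lambda>k. (\<Sum>i<n. x i ^ k) * (\<Sum>j<n. y j ^ k) / real k)"
  define a where "a = (\<lambda>z :: nat \<Rightarrow> real. \<lambda>g. det (mat n n (\<lambda>(i, j). z i ^ g j)))"
  let ?L = "\<Prod>i<n. \<Prod>j<n. 1 - fps_const (x i * y j) * fps_X"
  interpret c: comm_ring_hom "fps_const :: real \<Rightarrow> real fps"
    by unfold_locales auto
  have W: "W z \<noteq> 0" if "inj_on z {..<n}" for z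
  proof -
    have "z j - z r \<noteq> 0" if "j \<in> {..<n}" "r \<in> {j<..<n}" for j r
      using inj_onD[OF \<open>inj_on z {..<n}\<close>, of j r] that by auto
    then show ?thesis
      by (simp only: W_def prod_zero_iff finite_lessThan finite_greaterThanLessThan) blast
  qed
  have "(\<lambda>k. (\<Sum>i<n. x i ^ k) * (\<Sum>j<n. y j ^ k) / real k)
      = (\<lambda>k. (\<Sum>(i, j)\<in>{..<n} \<times> {..<n}. (x i * y j) ^ k) / real k)"
    by (simp add: sum_product sum.cartesian_product power_mult_distrib)
  then have H: "Abs_fps H * ?L = 1"
    using complete_hom_sum_power_sums[of "{..<n} \<times> {..<n}" "\<lambda>(i, j). x i * y j"]
    by (simp add: H_def prod.cartesian_product case_prod_beta)
  have "C i j * (1 - (fps_const (x i) * fps_X) * fps_const (y j)) = 1" for i j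
  proof (rule fps_ext)
    fix m
    have e: "C i j * (1 - (fps_const (x i) * fps_X) * fps_const (y j)) = C i j * (1 - fps_const (x i * y j) * fps_X)"
      by (simp add: algebra_simps flip: fps_const_mult)
    show "fps_nth (C i j * (1 - (fps_const (x i) * fps_X) * fps_const (y j))) m = fps_nth 1 m"
      unfolding e by (cases m) (simp_all add: C_def fps_mult_linear_nth)
  qed
  then have "det (mat n n (\<lambda>(i, j). C i j)) * (\<Prod>i<n. \<Prod>j<n. 1 - (fps_const (x i) * fps_X) * fps_const (y j))
    = (\<Prod>j<n. \<Prod>r\<in>{j<..<n}. fps_const (x j) * fps_X - fps_const (x r) * fps_X)
      * (\<Prod>j<n. \<Prod>r\<in>{j<..<n}. fps_const (y j) - fps_const (y r))"
    by (intro cauchy_determinant)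
  also have "(\<Prod>i<n. \<Prod>j<n. 1 - (fps_const (x i) * fps_X) * fps_const (y j)) = ?L"
    by (simp add: ac_simps flip: fps_const_mult)
  \<comment> \<open>Every difference of x-variables carries one X, hence the shift by M, which is
    also the size of the staircase.\<close>
  also have "(\<Prod>j<n. \<Prod>r\<in>{j<..<n}. fps_const (x j) * fps_X - fps_const (x r) * fps_X) = fps_const (W x) * fps_X ^ M"
  proof -
    have "fps_const (x j) * fps_X - fps_const (x r) * fps_X = fps_const (x j - x r) * fps_X" for j r
      by (simp add: algebra_simps flip: fps_const_sub)
    then show ?thesis by (simp add: W_def M_def prod.distrib c.hom_prod power_sum del: fps_const_sub)
  qed
  also have "(\<Prod>j<n. \<Prod>r\<in>{j<..<n}. fps_const (y j) - fps_const (y r)) = fps_const (W y)"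
    by (simp add: W_def c.hom_prod)
  finally have "det (mat n n (\<lambda>(i, j). C i j)) * ?L = fps_const (W x) * fps_X ^ M * fps_const (W y)" .
  then have "det (mat n n (\<lambda>(i, j). C i j)) * (Abs_fps H * ?L)
      = fps_const (W x) * fps_X ^ M * fps_const (W y) * Abs_fps H"
    by (simp only: mult.assoc mult.left_commute mult.commute)
  then have "fps_nth (det (mat n n (\<lambda>(i, j). C i j))) (N + M) = W x * W y * H N"
    unfolding H by (simp add: mult.assoc fps_X_power_mult_nth mult.left_commute)
  also have "fps_nth (det (mat n n (\<lambda>(i, j). C i j))) (N + M)
      = (\<Sum>g | g \<in> strict_dec n (Suc (N + M)) \<and> (\<Sum>j<n. g j) = N + M. a x g * a y g)"
    unfolding C_def a_def by (rule fps_nth_det_geometric)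
  also have "\<dots> = (\<Sum>lam | lam \<in> int_partitions \<and> sum_list lam = N.
      a x (restrict (shifted_part n lam) {0..<n}) * a y (restrict (shifted_part n lam) {0..<n}))"
    using sum.reindex_bij_betw[OF bij_betw_shifted_part[OF N], of "\<lambda>g. a x g * a y g"] by (simp add: M_def)
  also have "\<dots> = (\<Sum>lam | lam \<in> int_partitions \<and> sum_list lam = N.
      W x * W y * (schur lam (\<lambda>k. (\<Sum>i<n. x i ^ k) / real k) * schur lam (\<lambda>k. (\<Sum>i<n. y i ^ k) / real k)))"
  proof (rule sum.cong)
    fix lam assume "lam \<in> {lam. lam \<in> int_partitions \<and> sum_list lam = N}"
    then have len: "length lam \<le> n" using length_le_sum_list[of lam] N by simp
    have "a z (restrict (shifted_part n lam) {0..<n}) = schur lam (\<lambda>k. (\<Sum>i<n. z i ^ k) / real k) * W z" for z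
    proof -
      have "mat n n (\<lambda>(i, j). z i ^ restrict (shifted_part n lam) {0..<n} j)
          = mat n n (\<lambda>(i, j). z i ^ (part lam (j + 1) + (n - 1 - j)))"
        by (rule eq_matI) (auto simp: shifted_part_def)
      then show ?thesis
        using schur_bialternant[OF len, of z] unfolding a_def W_def det_vandermonde by (simp only:)
    qed
    then show "a x (restrict (shifted_part n lam) {0..<n}) * a y (restrict (shifted_part n lam) {0..<n})
      = W x * W y * (schur lam (\<lambda>k. (\<Sum>i<n. x i ^ k) / real k) * schur lam (\<lambda>k. (\<Sum>i<n. y i ^ k) / real k))"
      by simp
  qed simp
  finally show ?thesis
    using W[OF inj(1)] W[OF inj(2)] by (simp add: H_def flip: sum_distrib_left)
qed

section \<open>The Cauchy identity for the two specializations\<close>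

text \<open>The times of the variables 1, q, q^2, and so on, whose k-th power sum is 1 / (1 -
  q^k).\<close>

definition geom_times :: "real \<Rightarrow> nat \<Rightarrow> real" where
  "geom_times q k = 1 / (real k * (1 - q ^ k))"

definition unit_times :: "nat \<Rightarrow> real" where
  "unit_times k = (if k = 1 then 1 else 0)"

abbreviation partitions_of :: "nat \<Rightarrow> nat list set" where
  "partitions_of N \<equiv> {lam. lam \<in> int_partitions \<and> sum_list lam = N}"

lemma geometric_power_sums_tendsto:
  assumes "0 < q" "q < 1" "k \<ge> 1"
  shows "(\<lambda>n. \<Sum>i<n. (q ^ i) ^ k) \<longlonglongrightarrow> 1 / (1 - q ^ k :: real)"
proof -
  have "(\<lambda>i. (q ^ k) ^ i) sums (1 / (1 - q ^ k))"
    using assms by (intro geometric_sums) (auto simp: power_less_one_iff)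
  then show ?thesis by (simp add: sums_def mult.commute flip: power_mult)
qed

text \<open>Truncation to the distinct variables q^i and p^i with i < n gives the finite identity
  once n \<ge> N, and both sides are continuous in the times. The parameters are kept separate
  because p is later sent to 1.\<close>

lemma cauchy_geometric:
  assumes q: "0 < q" "q < 1" and p: "0 < p" "p < 1"
  shows "(\<Sum>lam\<in>partitions_of N. schur lam (geom_times q) * schur lam (geom_times p))
    = complete_hom (\<lambda>k. real k * geom_times q k * geom_times p k) N"
proof (rule LIMSEQ_unique)
  define S where "S = (\<lambda>q n k. (\<Sum>i<n. (q ^ i) ^ k :: real))"
  have S: "(\<lambda>n. S r n k) \<longlonglongrightarrow> 1 / (1 - r ^ k)" if "0 < r" "r < 1" "k \<ge> 1" for r k
    unfolding S_def by (rule geometric_power_sums_tendsto) (use that in auto)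
  have St: "(\<lambda>n. S r n k / real k) \<longlonglongrightarrow> geom_times r k" if "0 < r" "r < 1" "k \<ge> 1" for r k
    using tendsto_divide[OF S[OF that] tendsto_const[of "real k"]] that
    by (simp add: geom_times_def mult.commute)
  show "(\<lambda>n. \<Sum>lam\<in>partitions_of N. schur lam (\<lambda>k. S q n k / real k) * schur lam (\<lambda>k. S p n k / real k))
      \<longlonglongrightarrow> (\<Sum>lam\<in>partitions_of N. schur lam (geom_times q) * schur lam (geom_times p))"
    by (intro tendsto_sum tendsto_mult tendsto_schur St q p)
  have "(\<lambda>n. complete_hom (\<lambda>k. S q n k * S p n k / real k) N)
      \<longlonglongrightarrow> complete_hom (\<lambda>k. real k * geom_times q k * geom_times p k) N"
  proof (rule tendsto_complete_hom)
    fix k :: nat assume k: "k \<ge> 1"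
    have "(\<lambda>n. S q n k * S p n k / real k) \<longlonglongrightarrow> 1 / (1 - q ^ k) * (1 / (1 - p ^ k)) / real k"
      using k by (intro tendsto_intros S q p) auto
    then show "(\<lambda>n. S q n k * S p n k / real k) \<longlonglongrightarrow> real k * geom_times q k * geom_times p k"
      using k by (simp add: geom_times_def ac_simps)
  qed
  then show "(\<lambda>n. \<Sum>lam\<in>partitions_of N. schur lam (\<lambda>k. S q n k / real k) * schur lam (\<lambda>k. S p n k / real k))
      \<longlonglongrightarrow> complete_hom (\<lambda>k. real k * geom_times q k * geom_times p k) N"
  proof (rule Lim_transform_eventually)
    have inj: "inj_on (\<lambda>i. r ^ i) {..<n}" if "0 < r" "r < 1" for r :: real and n :: nat
      using that by (auto simp: inj_on_def power_inject_exp')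
    show "eventually (\<lambda>n. complete_hom (\<lambda>k. S q n k * S p n k / real k) N
        = (\<Sum>lam\<in>partitions_of N. schur lam (\<lambda>k. S q n k / real k) * schur lam (\<lambda>k. S p n k / real k))) sequentially"
      using eventually_ge_at_top[of N]
      by eventually_elim (simp add: S_def finite_cauchy_identity[OF inj[OF q] inj[OF p]])
  qed
qed

text \<open>Both sides are homogeneous and acquire the factor (a c)^N. This serves the limit p -> 1
  as well as the scalings by \<xi> sqrt q and \<xi> / sqrt q.\<close>

lemma cauchy_scale:
  assumes "(\<Sum>lam\<in>partitions_of N. schur lam t * schur lam t') = complete_hom (\<lambda>k. real k * t k * t' k) N"
  shows "(\<Sum>lam\<in>partitions_of N. schur lam (\<lambda>k. a ^ k * t k) * schur lam (\<lambda>k. c ^ k * t' k))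
    = complete_hom (\<lambda>k. real k * (a ^ k * t k) * (c ^ k * t' k)) N"
proof -
  have "(\<Sum>lam\<in>partitions_of N. schur lam (\<lambda>k. a ^ k * t k) * schur lam (\<lambda>k. c ^ k * t' k))
      = (\<Sum>lam\<in>partitions_of N. (a * c) ^ N * (schur lam t * schur lam t'))"
    by (intro sum.cong) (auto simp: schur_scale power_mult_distrib)
  also have "\<dots> = complete_hom (\<lambda>k. (a * c) ^ k * (real k * t k * t' k)) N"
    unfolding complete_hom_scale assms[symmetric] by (rule sum_distrib_left[symmetric])
  finally show ?thesis by (simp add: power_mult_distrib ac_simps)
qed

lemma unit_times_limit:
  assumes "k \<ge> 1"
  shows "((\<lambda>p. (1 - p) ^ k * geom_times p k) \<longlongrightarrow> unit_times k) (at_left 1)"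
  using exponential_limit[OF assms] unfolding geom_times_def unit_times_def .

lemma cauchy_exponential:
  assumes q: "0 < q" "q < 1"
  shows "(\<Sum>lam\<in>partitions_of N. schur lam (geom_times q) * schur lam unit_times)
    = complete_hom (\<lambda>k. real k * geom_times q k * unit_times k) N"
proof (rule tendsto_unique)
  let ?f = "\<lambda>p k. (1 - p) ^ k * geom_times p k"
  show "((\<lambda>p. \<Sum>lam\<in>partitions_of N. schur lam (geom_times q) * schur lam (?f p))
      \<longlongrightarrow> (\<Sum>lam\<in>partitions_of N. schur lam (geom_times q) * schur lam unit_times)) (at_left 1)"
    by (intro tendsto_sum tendsto_mult tendsto_const tendsto_schur unit_times_limit)
  have "((\<lambda>p. complete_hom (\<lambda>k. real k * geom_times q k * ?f p k) N)
      \<longlongrightarrow> complete_hom (\<lambda>k. real k * geom_times q k * unit_times k) N) (at_left 1)"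
    by (intro tendsto_complete_hom tendsto_mult tendsto_const unit_times_limit)
  then show "((\<lambda>p. \<Sum>lam\<in>partitions_of N. schur lam (geom_times q) * schur lam (?f p))
      \<longlongrightarrow> complete_hom (\<lambda>k. real k * geom_times q k * unit_times k) N) (at_left 1)"
  proof (rule Lim_transform_eventually)
    have "eventually (\<lambda>p :: real. p \<in> {0<..<1}) (at_left 1)"
      by (rule eventually_at_left_real) simp
    then show "eventually (\<lambda>p. complete_hom (\<lambda>k. real k * geom_times q k * ?f p k) N
        = (\<Sum>lam\<in>partitions_of N. schur lam (geom_times q) * schur lam (?f p))) (at_left 1)"
    proof eventually_elim
      case (elim p)
      then show ?case
        using cauchy_scale[OF cauchy_geometric[OF q, of p], where a = 1 and c = "1 - p" and N = N] by simp
    qed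
  qed
qed simp

text \<open>Grouping by size identifies \<open>int_partitions\<close> with a disjoint union of
  finite fibres. Nonnegativity turns convergence of the fibre sums into unordered summability over
  all partitions.\<close>

lemma has_sum_partitions:
  fixes f :: "nat list \<Rightarrow> real"
  assumes nonneg: "\<And>lam. lam \<in> int_partitions \<Longrightarrow> 0 \<le> f lam"
    and g: "\<And>N. (\<Sum>lam\<in>partitions_of N. f lam) = g N" "g sums S"
  shows "(f has_sum S) int_partitions"
proof -
  have fin: "((\<lambda>lam. (f \<circ> snd) (N, lam)) has_sum g N) (partitions_of N)" for N
    using has_sum_finite[OF finite_partitions_of, of f N] g(1)[of N] by simp
  have "g N \<ge> 0" for N unfolding g(1)[symmetric] by (intro sum_nonneg) (auto simp: nonneg)
  then have gs: "(g has_sum S) UNIV"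
    using g(2) by (intro sums_nonneg_imp_has_sum) auto
  have "((f \<circ> snd) has_sum S) (SIGMA N:UNIV. partitions_of N)"
  proof (rule has_sum_SigmaI[OF fin gs])
    show "(f \<circ> snd) summable_on (SIGMA N:UNIV. partitions_of N)"
      using gs nonneg by (intro summable_on_SigmaI[OF fin]) (auto simp: summable_on_def)
  qed
  moreover have "inj_on snd (SIGMA N:UNIV. partitions_of N)"
    by (auto simp: inj_on_def)
  ultimately have "(f has_sum S) (snd ` (SIGMA N:UNIV. partitions_of N))"
    by (simp add: has_sum_reindex)
  also have "snd ` (SIGMA N:UNIV. partitions_of N) = int_partitions"
    by force
  finally show ?thesis .
qed


section \<open>The normalizations\<close>

lemma complete_hom_unit: "complete_hom unit_times n = 1 / fact n"
proof (induction n)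
  case (Suc n)
  have "(\<Sum>i\<le>n. real (Suc i) * unit_times (Suc i) * complete_hom unit_times (n - i))
      = (\<Sum>i\<le>n. if i = 0 then complete_hom unit_times n else 0)"
    by (intro sum.cong) (auto simp: unit_times_def)
  also have "\<dots> = complete_hom unit_times n" by simp
  finally have "complete_hom unit_times (Suc n) = complete_hom unit_times n / real (Suc n)"
    by (simp only: complete_hom_Suc)
  then show ?case using Suc by (simp add: field_simps)
qed simp

lemma complete_hom_sums_exp:
  assumes "\<And>k. k \<ge> 1 \<Longrightarrow> t k = (if k = 1 then c else 0)"
  shows "complete_hom t sums exp c"
proof -
  have "complete_hom t = complete_hom (\<lambda>k. c ^ k * unit_times k)"
    by (rule complete_hom_cong) (auto simp: assms unit_times_def)
  also have "\<dots> = (\<lambda>n. c ^ n /\<^sub>R fact n)"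
    by (rule ext) (simp only: complete_hom_scale complete_hom_unit, simp add: field_simps)
  finally show ?thesis using exp_converges[of c] by simp
qed

text \<open>Bernoulli's inequality bounds 1 - (1 - w)^n by n w, so absolute convergence reduces to
  the series of n q^n.\<close>

lemma macmahon_convergent:
  fixes z q :: real
  assumes q: "0 \<le> q" "q < 1" and z: "0 \<le> z" "z < 1"
  shows "convergent_prod (\<lambda>n. inverse ((1 - z * q ^ Suc n) ^ Suc n))"
proof -
  let ?w = "\<lambda>n. z * q ^ Suc n"
  have w: "0 \<le> ?w n" "?w n < 1" for n
  proof -
    have "?w n \<le> z * 1" using q z by (intro mult_left_mono power_le_one) auto
    then show "?w n < 1" "0 \<le> ?w n" using z q by auto
  qed
  have "(\<lambda>n. real (Suc n) * q ^ n) sums (1 / (1 - q)\<^sup>2)"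
    using geometric_deriv_sums[of q] q by simp
  then have "summable (\<lambda>n. z * q * (real (Suc n) * q ^ n))"
    by (intro summable_mult) (simp add: sums_iff)
  then have "summable (\<lambda>n. norm ((1 - ?w n) ^ Suc n - 1))"
  proof (rule summable_comparison_test_ev[rotated], intro always_eventually allI)
    fix n
    have "1 + real (Suc n) * (- ?w n) \<le> (1 + (- ?w n)) ^ Suc n"
      using w[of n] by (intro Bernoulli_inequality) simp
    moreover have "(1 - ?w n) ^ Suc n \<le> 1" using w[of n] by (intro power_le_one) auto
    ultimately show "norm (norm ((1 - ?w n) ^ Suc n - 1)) \<le> z * q * (real (Suc n) * q ^ n)"
      by (simp add: algebra_simps)
  qed
  then have "abs_convergent_prod (\<lambda>n. (1 - ?w n) ^ Suc n)"
    by (simp only: abs_convergent_prod_conv_summable)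
  then have "convergent_prod (\<lambda>n. (1 - ?w n) ^ Suc n)"
    by (rule abs_convergent_prod_imp_convergent_prod)
  then show ?thesis by (rule convergent_prod_inverse)
qed

text \<open>The \<open>t\<close>-variables are approximated from below by those of finitely many variables
  \<open>\<xi>\<^sup>2 q\<^bsup>m+1\<^esup>\<close> of multiplicity \<open>m + 1\<close>, for which the sum is a partial product.\<close>

lemma complete_hom_sums_macmahon:
  assumes q: "0 < q" "q < 1" and \<xi>: "0 \<le> \<xi>" "\<xi> < 1"
    and T: "\<And>k. k \<ge> 1 \<Longrightarrow> T k = (\<xi>\<^sup>2 * q) ^ k / (real k * (1 - q ^ k)\<^sup>2)"
  shows "complete_hom T sums macmahon \<xi> q"
proof -
  define z where "z = \<xi>\<^sup>2"
  have z: "0 \<le> z" "z < 1" using \<xi> by (simp_all add: z_def power_less_one_iff abs_square_less_1)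
  define w where "w = (\<lambda>n. z * q ^ Suc n)"
  have w: "0 \<le> w n" "w n < 1" for n
  proof -
    have "w n \<le> z * 1" unfolding w_def using q z by (intro mult_left_mono power_le_one) auto
    then show "w n < 1" "0 \<le> w n" using z q by (auto simp: w_def)
  qed
  define P where "P = (\<lambda>n. \<Prod>m<n. inverse ((1 - w m) ^ Suc m))"
  define u where "u = (\<lambda>n k. (\<Sum>(m, i)\<in>(SIGMA m:{..<n}. {..m}). w m ^ k) / real k)"
  have u_eq: "u n k = (\<Sum>m<n. real (Suc m) * w m ^ k) / real k" for n k
    unfolding u_def by (subst sum.Sigma[symmetric]) auto
  have u_sums: "complete_hom (u n) sums P n" for n
  proof -
    have "complete_hom (u n) sums (\<Prod>(m, i)\<in>(SIGMA m:{..<n}. {..m}). inverse (1 - w m))"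
      using complete_hom_sum_power_sums_sums[of "SIGMA m:{..<n}. {..m}" "\<lambda>(m, i). w m"] w
      by (simp add: u_def case_prod_beta)
    also have "(\<Prod>(m, i)\<in>(SIGMA m:{..<n}. {..m}). inverse (1 - w m)) = P n"
      unfolding P_def by (subst prod.Sigma[symmetric]) (auto simp: power_inverse)
    finally show ?thesis .
  qed
  \<comment> \<open>The multiplicity m + 1 is the coefficient in 1 / (1 - x)^2 = sum (m + 1) x^m at
    x = q^k, which produces the squared denominator.\<close>
  have sums_T: "(\<lambda>m. real (Suc m) * w m ^ k) sums (T k * real k)" if k: "k \<ge> 1" for k
  proof -
    have "(\<lambda>m. real (Suc m) * (q ^ k) ^ m) sums (1 / (1 - q ^ k)\<^sup>2)"
      using geometric_deriv_sums[of "q ^ k"] q k by (simp add: power_less_one_iff)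
    then have "(\<lambda>m. (z * q) ^ k * (real (Suc m) * (q ^ k) ^ m)) sums ((z * q) ^ k * (1 / (1 - q ^ k)\<^sup>2))"
      by (rule sums_mult)
    moreover have "(z * q) ^ k * (1 / (1 - q ^ k)\<^sup>2) = T k * real k" using k by (simp add: T z_def)
    moreover have "(z * q) ^ k * (real (Suc m) * (q ^ k) ^ m) = real (Suc m) * w m ^ k" for m
      by (simp add: w_def power_mult_distrib flip: power_mult) (simp add: mult.commute)
    ultimately show ?thesis by (simp only:)
  qed
  have u_lim: "(\<lambda>n. u n k) \<longlonglongrightarrow> T k" if k: "k \<ge> 1" for k
    using tendsto_divide[OF sums_T[OF k, unfolded sums_def] tendsto_const[of "real k"]] k
    by (simp add: u_eq)
  have u_nonneg: "0 \<le> u n k" for n k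
    unfolding u_eq using w by (intro divide_nonneg_nonneg sum_nonneg mult_nonneg_nonneg) auto
  have u_le: "u n k \<le> T k" if k: "k \<ge> 1" for n k
  proof -
    have "(\<Sum>m<n. real (Suc m) * w m ^ k) \<le> T k * real k"
      using sums_T[OF k] w unfolding sums_iff
      by (metis (no_types, lifting) sum_le_suminf finite_lessThan mult_nonneg_nonneg of_nat_0_le_iff zero_le_power)
    then show ?thesis using k by (simp add: u_eq pos_divide_le_eq)
  qed
  have h_nonneg: "0 \<le> complete_hom (u n) N" and h_le: "complete_hom (u n) N \<le> complete_hom T N" for n N
    using complete_hom_mono[of "u n" T N] u_nonneg u_le by auto
  have T_nonneg: "0 \<le> complete_hom T N" for N using h_nonneg h_le order.trans by blast
  have "(\<lambda>n. \<Prod>m\<le>n. inverse ((1 - w m) ^ Suc m)) \<longlonglongrightarrow> macmahon \<xi> q"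
    unfolding macmahon_def z_def[symmetric] w_def
    by (rule convergent_prod_LIMSEQ, rule macmahon_convergent) (use q z in auto)
  then have P_lim: "P \<longlonglongrightarrow> macmahon \<xi> q"
    unfolding P_def by (simp only: LIMSEQ_lessThan_iff_atMost[where f = "\<lambda>A. \<Prod>m\<in>A. inverse ((1 - w m) ^ Suc m)"])
  have "incseq P"
  proof (rule incseq_SucI)
    fix n
    have "0 \<le> P n" unfolding P_def using w by (intro prod_nonneg) (auto simp: less_imp_le)
    moreover have "1 \<le> inverse ((1 - w n) ^ Suc n)"
      using w[of n] by (intro one_le_inverse power_le_one zero_less_power) auto
    ultimately have "P n * 1 \<le> P n * inverse ((1 - w n) ^ Suc n)" by (intro mult_left_mono)
    then show "P n \<le> P (Suc n)" by (simp add: P_def)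
  qed
  then have P_le: "P n \<le> macmahon \<xi> q" for n using P_lim by (rule incseq_le)
  \<comment> \<open>With K fixed only finitely many degrees are involved, so n may tend to infinity
    termwise, and each sum is at most \<open>P n\<close>. This yields summability and the upper
    bound; the lower bound sums \<open>h_le\<close> over all degrees.\<close>
  have bound: "(\<Sum>N<K. complete_hom T N) \<le> macmahon \<xi> q" for K
  proof (rule LIMSEQ_le_const2)
    show "(\<lambda>n. \<Sum>N<K. complete_hom (u n) N) \<longlonglongrightarrow> (\<Sum>N<K. complete_hom T N)"
      by (intro tendsto_sum tendsto_complete_hom u_lim)
    have "(\<Sum>N<K. complete_hom (u n) N) \<le> P n" for n
      using u_sums[of n] h_nonneg[of n] unfolding sums_iff by (metis sum_le_suminf finite_lessThan)
    then show "\<exists>n0. \<forall>n\<ge>n0. (\<Sum>N<K. complete_hom (u n) N) \<le> macmahon \<xi> q"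
      using P_le order.trans by blast
  qed
  have sm: "summable (complete_hom T)"
    using T_nonneg bound by (rule summableI_nonneg_bounded)
  have "suminf (complete_hom T) \<le> macmahon \<xi> q"
    using sm bound by (rule suminf_le_const)
  moreover have "macmahon \<xi> q \<le> suminf (complete_hom T)"
  proof (rule LIMSEQ_le_const2[OF P_lim], intro exI allI impI)
    fix n
    have "suminf (complete_hom (u n)) \<le> suminf (complete_hom T)"
      using h_le u_sums[of n] sm by (intro suminf_le) (auto simp: sums_iff)
    then show "P n \<le> suminf (complete_hom T)" using u_sums[of n] by (simp add: sums_iff)
  qed
  ultimately show ?thesis using sm by (simp add: sums_iff)
qed

section \<open>The two \<open>q\<close>-Plancherel measures\<close>

text \<open>From - 1 / (q^(k/2) - q^(-k/2)) = q^(k/2) / (1 - q^k): these are the times of the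
  variables \<xi> q^(i+1/2), i \<ge> 0.\<close>

lemma q_times_eq:
  assumes "0 < q" "q < 1" "k \<ge> 1"
  shows "q_times \<xi> q k = (\<xi> * sqrt q) ^ k * geom_times q k"
proof -
  define s where "s = sqrt q ^ k"
  have s: "0 < s" "s\<^sup>2 = q ^ k"
    using assms by (simp_all add: s_def power2_eq_square flip: power_mult_distrib)
  have p: "q powr (real k / 2) = s"
    using assms powr_powr[of q "1 / 2" "real k"] by (simp add: s_def powr_half_sqrt powr_realpow)
  have m: "q powr (- real k / 2) = inverse s"
    using powr_minus[of q "real k / 2"] by (simp add: p)
  have "q ^ k < 1" using assms by (simp add: power_less_one_iff)
  then have ne: "1 - s\<^sup>2 \<noteq> 0" using s by simp
  have "s - inverse s = - ((1 - s\<^sup>2) / s)"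
    using s by (simp add: field_simps power2_eq_square)
  then have "q_times \<xi> q k = \<xi> ^ k * s / (real k * (1 - s\<^sup>2))"
    unfolding q_times_def p m using s ne assms by simp
  then show ?thesis by (simp add: geom_times_def s power_mult_distrib flip: s_def)
qed

lemma exp_times_eq:
  assumes "0 < q" "k \<ge> 1"
  shows "exp_times \<xi> q k = (\<xi> / sqrt q) ^ k * unit_times k"
proof -
  have "q powr (- 1 / 2) = inverse (sqrt q)"
    using assms powr_minus[of q "1 / 2"] by (simp add: powr_half_sqrt)
  then have "exp_times \<xi> q k = \<xi> * inverse (sqrt q) * (if k = 1 then 1 else 0)"
    by (simp only: exp_times_def)
  then show ?thesis by (cases "k = 1") (simp_all add: unit_times_def field_simps)
qed

lemma schur_q_times:
  assumes "0 < q" "q < 1" "lam \<in> int_partitions"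
  shows "schur lam (q_times \<xi> q)
    = (\<xi> * sqrt q) ^ sum_list lam * (q ^ b_stat lam * (\<Prod>c\<in>diagram lam. 1 / (1 - q ^ hook lam c)))"
proof -
  have "schur lam (q_times \<xi> q) = schur lam (\<lambda>k. (\<xi> * sqrt q) ^ k * geom_times q k)"
    by (rule schur_cong) (rule q_times_eq[OF assms(1,2)])
  then show ?thesis
    unfolding schur_scale using schur_geometric[OF assms] by (simp only: geom_times_def[abs_def])
qed

lemma schur_exp_times:
  assumes "0 < q" "lam \<in> int_partitions"
  shows "schur lam (exp_times \<xi> q)
    = (\<xi> / sqrt q) ^ sum_list lam * (\<Prod>c\<in>diagram lam. 1 / real (hook lam c))"
proof -
  have "schur lam (exp_times \<xi> q) = schur lam (\<lambda>k. (\<xi> / sqrt q) ^ k * unit_times k)"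
    by (rule schur_cong) (rule exp_times_eq[OF assms(1)])
  then show ?thesis
    unfolding schur_scale using schur_exponential[OF assms(2)] by (simp only: unit_times_def[abs_def])
qed

lemma schur_q_times_nonneg:
  assumes "0 < q" "q < 1" "0 \<le> \<xi>" "lam \<in> int_partitions"
  shows "0 \<le> schur lam (q_times \<xi> q)"
proof -
  have "q ^ hook lam c \<le> 1" for c using assms by (intro power_le_one) auto
  then have "0 \<le> (\<Prod>c\<in>diagram lam. 1 / (1 - q ^ hook lam c))" by (intro prod_nonneg) simp
  moreover have "0 \<le> (\<xi> * sqrt q) ^ sum_list lam" "0 \<le> q ^ b_stat lam" using assms by simp_all
  ultimately show ?thesis
    by (simp only: schur_q_times[OF assms(1,2,4)] mult_nonneg_nonneg)
qed

lemma schur_exp_times_nonneg: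
  assumes "0 < q" "0 \<le> \<xi>" "lam \<in> int_partitions"
  shows "0 \<le> schur lam (exp_times \<xi> q)"
proof -
  have "0 \<le> (\<Prod>c\<in>diagram lam. 1 / real (hook lam c))" by (intro prod_nonneg) simp
  moreover have "0 \<le> (\<xi> / sqrt q) ^ sum_list lam" using assms by simp
  ultimately show ?thesis by (simp only: schur_exp_times[OF assms(1,3)] mult_nonneg_nonneg)
qed

text \<open>Vanishing times are unchanged by scaling with 0, so homogeneity gives s = 0^|\<lambda>|
  s.\<close>

lemma schur_zero:
  assumes "lam \<in> int_partitions" "\<And>k. k \<ge> 1 \<Longrightarrow> t k = 0"
  shows "schur lam t = (if lam = [] then 1 else 0)"
proof -
  have "schur lam t = schur lam (\<lambda>k. 0 ^ k * t k)"
    by (rule schur_cong) (simp add: assms)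
  also have "\<dots> = 0 ^ sum_list lam * schur lam t" by (rule schur_scale)
  finally have s: "schur lam t = 0 ^ sum_list lam * schur lam t" .
  show ?thesis
  proof (cases "lam = []")
    case True
    then show ?thesis by (simp add: schur_def jacobi_trudi_mat_def)
  next
    case False
    then have "sum_list lam \<noteq> 0"
      using length_le_sum_list[OF assms(1)] by (metis le_zero_eq length_0_conv)
    then have "schur lam t = 0" using s by (simp only: power_0_left if_False mult_zero_left)
    then show ?thesis using False by simp
  qed
qed

text \<open>By the conventions for \<open>powr\<close> and division all times vanish at q = 0, and
  both sides are the point mass at the empty partition.\<close>

lemma schur_measure_q_times_zero:
  assumes lam: "lam \<in> int_partitions"
  shows "schur_measure lam (q_times \<xi> 0) (q_times \<xi> 0) = qPP_S lam \<xi> 0"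
proof -
  have s: "schur mu (q_times \<xi> 0) = (if mu = [] then 1 else 0)" if "mu \<in> int_partitions" for mu
    by (rule schur_zero[OF that]) (simp add: q_times_def)
  have "(\<Sum>\<^sub>\<infinity>mu\<in>int_partitions. schur mu (q_times \<xi> 0) * schur mu (q_times \<xi> 0)) = (\<Sum>\<^sub>\<infinity>mu\<in>{[] :: nat list}. 1)"
    by (rule infsum_cong_neutral) (auto simp: s, auto simp: int_partitions_def)
  then have "schur_measure lam (q_times \<xi> 0) (q_times \<xi> 0) = (if lam = [] then 1 else 0)"
    using s[OF lam] by (simp add: schur_measure_def)
  moreover have "qPP_S lam \<xi> 0 = (if lam = [] then 1 else 0)"
    using length_le_sum_list[OF lam]
    by (cases lam) (auto simp: qPP_S_def macmahon_def b_stat_def diagram_eq)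
  ultimately show ?thesis by simp
qed

lemma schur_measure_q_times:
  assumes q: "0 < q" "q < 1" and \<xi>: "0 \<le> \<xi>" "\<xi> < 1" and lam: "lam \<in> int_partitions"
  shows "schur_measure lam (q_times \<xi> q) (q_times \<xi> q) = qPP_S lam \<xi> q"
proof -
  let ?t = "\<lambda>k. (\<xi> * sqrt q) ^ k * geom_times q k"
  let ?T = "\<lambda>k. real k * ?t k * ?t k"
  have t: "schur mu (q_times \<xi> q) = schur mu ?t" for mu
    by (rule schur_cong) (rule q_times_eq[OF q])
  have "?T k = (\<xi>\<^sup>2 * q) ^ k / (real k * (1 - q ^ k)\<^sup>2)" if "k \<ge> 1" for k
  proof -
    have "(\<xi> * sqrt q) ^ k * (\<xi> * sqrt q) ^ k = (\<xi>\<^sup>2 * q) ^ k"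
      using q by (simp add: power2_eq_square ac_simps flip: power_mult_distrib)
    moreover have "?T k = (\<xi> * sqrt q) ^ k * (\<xi> * sqrt q) ^ k * (real k * geom_times q k * geom_times q k)"
      by (simp only: ac_simps)
    moreover have "real k * geom_times q k * geom_times q k = 1 / (real k * (1 - q ^ k)\<^sup>2)"
      using that by (simp add: geom_times_def power2_eq_square)
    ultimately show ?thesis by (simp only:) simp
  qed
  then have "complete_hom ?T sums macmahon \<xi> q"
    by (intro complete_hom_sums_macmahon q \<xi>)
  then have "((\<lambda>mu. schur mu (q_times \<xi> q) * schur mu (q_times \<xi> q)) has_sum macmahon \<xi> q) int_partitions"
    using schur_q_times_nonneg[OF q \<xi>(1)] cauchy_scale[OF cauchy_geometric[OF q q]]
    by (intro has_sum_partitions[where g = "complete_hom ?T"]) (simp_all add: t)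
  then have Z: "(\<Sum>\<^sub>\<infinity>mu\<in>int_partitions. schur mu (q_times \<xi> q) * schur mu (q_times \<xi> q)) = macmahon \<xi> q"
    by (rule infsumI)
  have rearrange: "a * (b * c) * (a * (b * c)) = (a * a) * (b * b) * (c * c)" for a b c :: real
    by (simp only: ac_simps)
  have "(\<xi> * sqrt q) ^ sum_list lam * (\<xi> * sqrt q) ^ sum_list lam = (\<xi>\<^sup>2 * q) ^ sum_list lam"
    using q by (simp add: power2_eq_square ac_simps flip: power_mult_distrib)
  moreover have "(\<Prod>c\<in>diagram lam. 1 / (1 - q ^ hook lam c)) * (\<Prod>c\<in>diagram lam. 1 / (1 - q ^ hook lam c))
      = (\<Prod>c\<in>diagram lam. 1 / (1 - q ^ hook lam c)\<^sup>2)"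
    by (simp add: power2_eq_square flip: prod.distrib)
  moreover have "q ^ b_stat lam * q ^ b_stat lam = q ^ (2 * b_stat lam)"
    by (simp add: mult_2 flip: power_add)
  ultimately have s: "schur lam (q_times \<xi> q) * schur lam (q_times \<xi> q)
      = (\<xi>\<^sup>2 * q) ^ sum_list lam * q ^ (2 * b_stat lam) * (\<Prod>c\<in>diagram lam. 1 / (1 - q ^ hook lam c)\<^sup>2)"
    unfolding schur_q_times[OF q lam] rearrange by (simp only:)
  show ?thesis
    unfolding schur_measure_def Z s qPP_S_def by (simp only: divide_inverse ac_simps)
qed

lemma schur_measure_exp_times:
  assumes q: "0 < q" "q < 1" and \<xi>: "0 \<le> \<xi>" and lam: "lam \<in> int_partitions"
  shows "schur_measure lam (q_times \<xi> q) (exp_times \<xi> q) = qPP_M lam \<xi> q"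
proof -
  let ?t = "\<lambda>k. (\<xi> * sqrt q) ^ k * geom_times q k" and ?u = "\<lambda>k. (\<xi> / sqrt q) ^ k * unit_times k"
  let ?T = "\<lambda>k. real k * ?t k * ?u k"
  have t: "schur mu (q_times \<xi> q) = schur mu ?t" for mu
    by (rule schur_cong) (rule q_times_eq[OF q])
  have u: "schur mu (exp_times \<xi> q) = schur mu ?u" for mu
    by (rule schur_cong) (rule exp_times_eq[OF q(1)])
  \<comment> \<open>The half powers of q in the two specializations cancel, so the only surviving
    time of the product is \<xi>^2 / (1 - q); this is the exponent of the normalization.\<close>
  have sq: "\<xi> * sqrt q * (\<xi> / sqrt q) = \<xi>\<^sup>2" using q by (simp add: power2_eq_square)
  have "complete_hom ?T sums exp (\<xi>\<^sup>2 / (1 - q))"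
  proof (rule complete_hom_sums_exp)
    fix k :: nat
    show "?T k = (if k = 1 then \<xi>\<^sup>2 / (1 - q) else 0)"
    proof (cases "k = 1")
      case True
      have "?T k = (\<xi> * sqrt q * (\<xi> / sqrt q)) / (1 - q)"
        unfolding True by (simp add: unit_times_def geom_times_def)
      then show ?thesis unfolding sq using True by simp
    qed (simp add: unit_times_def)
  qed
  then have "((\<lambda>mu. schur mu (q_times \<xi> q) * schur mu (exp_times \<xi> q)) has_sum exp (\<xi>\<^sup>2 / (1 - q))) int_partitions"
    using schur_q_times_nonneg[OF q \<xi>] schur_exp_times_nonneg[OF q(1) \<xi>] cauchy_scale[OF cauchy_exponential[OF q]]
    by (intro has_sum_partitions[where g = "complete_hom ?T"]) (simp_all add: t u)
  then have Z: "(\<Sum>\<^sub>\<infinity>mu\<in>int_partitions. schur mu (q_times \<xi> q) * schur mu (exp_times \<xi> q)) = exp (\<xi>\<^sup>2 / (1 - q))"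
    by (rule infsumI)
  have rearrange: "a * (b * c) * (d * e) = (a * d) * b * (c * e)" for a b c d e :: real
    by (simp only: ac_simps)
  have "(\<xi> * sqrt q) ^ sum_list lam * (\<xi> / sqrt q) ^ sum_list lam = \<xi> ^ (2 * sum_list lam)"
    by (simp only: sq power_mult flip: power_mult_distrib)
  moreover have "(\<Prod>c\<in>diagram lam. 1 / (1 - q ^ hook lam c)) * (\<Prod>c\<in>diagram lam. 1 / real (hook lam c))
      = (\<Prod>c\<in>diagram lam. 1 / (real (hook lam c) * (1 - q ^ hook lam c)))"
    by (simp add: mult.commute flip: prod.distrib)
  ultimately have s: "schur lam (q_times \<xi> q) * schur lam (exp_times \<xi> q)
      = \<xi> ^ (2 * sum_list lam) * q ^ b_stat lam * (\<Prod>c\<in>diagram lam. 1 / (real (hook lam c) * (1 - q ^ hook lam c)))"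
    unfolding schur_q_times[OF q lam] schur_exp_times[OF q(1) lam] rearrange by (simp only:)
  have e: "exp (- \<xi>\<^sup>2 / (1 - q)) = inverse (exp (\<xi>\<^sup>2 / (1 - q)))"
    by (simp flip: exp_minus)
  show ?thesis
    unfolding schur_measure_def Z s qPP_M_def e by (simp only: divide_inverse ac_simps)
qed

text \<open>Hook lengths are positive, so each denominator tends to the hook length itself and the
  weight is continuous from the right at q = 0.\<close>

lemma qPP_M_tendsto_0:
  assumes "lam \<in> int_partitions"
  shows "((\<lambda>r. qPP_M lam \<xi> r) \<longlongrightarrow> qPP_M lam \<xi> 0) (at_right 0)"
  unfolding qPP_M_def using hook_pos[OF assms]
  by (intro tendsto_intros) (auto simp: power_0_left)

theorem proposition2p4:
  fixes q \<xi> :: real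
  assumes "0 \<le> q" "q < 1" "0 \<le> \<xi>" "\<xi> < 1"
  shows "(\<forall>lam\<in>int_partitions. schur_measure lam (q_times \<xi> q) (q_times \<xi> q) = qPP_S lam \<xi> q) \<and>
    (0 < q \<longrightarrow>
      (\<forall>lam\<in>int_partitions. schur_measure lam (q_times \<xi> q) (exp_times \<xi> q) = qPP_M lam \<xi> q)) \<and>
    (q = 0 \<longrightarrow>
      (\<forall>lam\<in>int_partitions.
        ((\<lambda>r. schur_measure lam (q_times \<xi> r) (exp_times \<xi> r)) \<longlongrightarrow> qPP_M lam \<xi> 0) (at_right 0)))"
proof (intro conjI ballI impI)
  fix lam assume lam: "lam \<in> int_partitions"
  show "schur_measure lam (q_times \<xi> q) (q_times \<xi> q) = qPP_S lam \<xi> q"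
    using assms lam schur_measure_q_times schur_measure_q_times_zero by (cases "q = 0") auto
  show "schur_measure lam (q_times \<xi> q) (exp_times \<xi> q) = qPP_M lam \<xi> q" if "0 < q"
    using assms lam that by (intro schur_measure_exp_times)
  \<comment> \<open>Close to 0 from the right the case 0 < r < 1 applies. For \<xi> > 0 the times
    \<open>exp_times \<xi> r\<close> diverge there, but their half powers cancel against those of
    \<open>q_times\<close>, and continuity of the mixed weight gives the limit.\<close>
  have "eventually (\<lambda>r :: real. r \<in> {0<..<1}) (at_right 0)"
    by (rule eventually_at_right_real) simp
  then have "eventually (\<lambda>r. qPP_M lam \<xi> r = schur_measure lam (q_times \<xi> r) (exp_times \<xi> r)) (at_right 0)"
    by eventually_elim (use assms lam in \<open>simp add: schur_measure_exp_times\<close>)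
  then show "((\<lambda>r. schur_measure lam (q_times \<xi> r) (exp_times \<xi> r)) \<longlongrightarrow> qPP_M lam \<xi> 0) (at_right 0)"
    by (rule Lim_transform_eventually[OF qPP_M_tendsto_0[OF lam]])
qed

end
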